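(* Let $B$ be a bar of $T(f,g)$, let $z\in N(B)$, and let $B^*$ be the postbar of $B$ supported at $z$. Then $$m(B^* )+1=n(B^* ).$$ In particular, $B^*$ is non-collinear. Moreover, every polar root which climbs over $B$ at $z$ must also climb over $B^*$; that is, there is no polar root $\gamma$ such that $$h(B)<O(\gamma,\lambda_{B^*})<h(B^* ).$$
   Context: SETTING. Let $f,g:(\mathbb C^2,O)\to(\mathbb C,O)$ be holomorphic germs in coordinates $(x,y)$, with Newton–Puiseux factorisations $f=u\,y^{E_1}\prod_{i=1}^p[x-\alpha_i(y)]$, $g=u'\,y^{E_2}\prod_{j=1}^q[x-\beta_j(y)]$, where $E_1,E_2\ge 0$, $u,u'$ are units and $\alpha_i,\beta_j$ are fractional power series in $y$ of positive order $O_y$. Write $\lambda_1,\dots,\lambda_N$ ($N=p+q\ge1$) for $\alpha_1,\dots,\alpha_p,\beta_1,\dots,\beta_q$; they are assumed pairwise distinct. Put $O(\lambda,\mu):=O_y(\lambda(y)-\mu(y))$ (contact order). An arc is a fractional power series in $y$. Let $J=f_yg_x-f_xg_y$. A polar root is a Newton–Puiseux root $x=\gamma(y)$ of $J$ with $O_y(\gamma)>0$ and $f(\gamma(y),y)g(\gamma(y),y)\ne0$. TREE $T(f,g)$. The ground bar $B_*$ has height $h(B_* )=0$ and carries one trunk (the main trunk), consisting of all $\lambda_k$. On top of each trunk there is one bar $B$ whose height $h(B)$ is the minimum of the contact orders between members of the trunk ($\infty$ if the trunk has one member); the members of the trunk are divided into classes by $\lambda\equiv\mu$ iff $O(\lambda,\mu)>h(B)$,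 and each class is a trunk growing on $B$; continue recursively. Bars of infinite height are omitted: "bar" (and "postbar") means bar of finite height. A trunk consisting of $s$ of the $\alpha_i$ and $t$ of the $\beta_j$ has bimultiplicity $[s,t]$. For a bar $B$ and a root $\lambda_k$ in a trunk on $B$, let $\lambda_B$ be $\lambda_k$ with all terms $y^e$, $e\ge h(B)$, omitted (independent of the choice of $\lambda_k$; $\lambda_{B_*}=0$). Then $\lambda_k=\lambda_B+cy^{h(B)}+\cdots$, and the trunk containing $\lambda_k$ is said to grow on $B$ at $c\in\mathbb C$ (the main trunk grows on $B_*$ at $0$). The bar $B^*$ on top of a trunk growing on $B$ at $c$ is called the postbar of $B$ supported at $c$. An arc $\xi$ climbs over $B$ at $a\in\mathbb C$ if $\xi=\lambda_B+ay^{h(B)}+\cdots$ ($\cdots$ meaning higher order terms). RATIONAL FUNCTION. For a bar $B$ and $F\in\{f,g\}$ let $\nu_F(B):=O_y(F(\lambda_B(y)+zy^{h(B)},y))$ for generic $z$ (so $\nu_f(B_* )=E_1$, $\nu_g(B_* )=E_2$). Let the trunks on $B$ grow at $z_1,\dots,z_l$ with bimultiplicities $[p_k,q_k]$. Put $\Delta_B(z_k):=\nu_f(B)q_k-\nu_g(B)p_k$ and $\mathcal M_B(z):=\sum_{k=1}^l\frac{\Delta_B(z_k)}{z-z_k}$. The point $z_k$ is collinear if $\Delta_B(z_k)=0$ and non-collinear otherwise; $N(B)$ is the set of non-collinear points among the $z_k$, $n(B)$ its cardinality. $B$ is non-collinear if $N(B)\neq\emptyset$. For a non-collinear $B$, $m(B)$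 is the total number of zeros of $\mathcal M_B$ in $\mathbb C$, counted with multiplicity. *)

theory Defs
  imports "HOL-Complex_Analysis.Complex_Analysis"
begin

section \<open>Fractional power series\<close>

text \<open>
  A series \<open>c(y) = \<Sum>\<^sub>e c\<^sub>e y\<^sup>e\<close> is represented by its coefficient function \<open>e \<mapsto> c\<^sub>e\<close>. The
  predicate \<open>puiseux_arc\<close> forces the support into \<open>(1/n) \<nat>\<close> for some \<open>n > 0\<close>, so real
  exponents are only a convenient index type.
\<close>

type_synonym frac_series = "real \<Rightarrow> complex"

definition ramified :: "nat \<Rightarrow> frac_series \<Rightarrow> bool" where
  "ramified n c \<longleftrightarrow> n > 0 \<and> (\<forall>e. c e \<noteq> 0 \<longrightarrow> (\<exists>k::nat. e = real k / real n))"

text \<open>If \<open>ramified n c\<close>, the following is the power series in \<open>t\<close> obtained from \<open>c(y)\<close> by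
  putting \<open>y = t\<^sup>n\<close>; \<open>of_fps n\<close> goes back, replacing \<open>t\<close> by \<open>y\<^bsup>1/n\<^esup>\<close>.\<close>

definition to_fps :: "nat \<Rightarrow> frac_series \<Rightarrow> complex fps" where
  "to_fps n c = Abs_fps (\<lambda>k. c (real k / real n))"

definition of_fps :: "nat \<Rightarrow> complex fps \<Rightarrow> frac_series" where
  "of_fps n A = (\<lambda>e. if e * real n \<in> \<nat> then fps_nth A (nat \<lfloor>e * real n\<rfloor>) else 0)"

text \<open>Arcs are convergent, so that holomorphic germs can be evaluated along them. For
  Newton-Puiseux roots of holomorphic germs this is automatic.\<close>

definition puiseux_arc :: "frac_series \<Rightarrow> bool" where
  "puiseux_arc c \<longleftrightarrow> (\<exists>n. ramified n c \<and> fps_conv_radius (to_fps n c) > 0)"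

text \<open>The order is \<open>\<infinity>\<close> for the zero series.\<close>

definition ord_y :: "frac_series \<Rightarrow> ereal" where
  "ord_y c = (INF e\<in>{e. c e \<noteq> 0}. ereal e)"

definition contact :: "frac_series \<Rightarrow> frac_series \<Rightarrow> ereal" where
  "contact c d = ord_y (\<lambda>e. c e - d e)"


section \<open>Holomorphic germs at the origin of \<open>\<complex>\<^sup>2\<close>\<close>

text \<open>Germs are represented by functions on \<open>\<complex>\<^sup>2\<close> of which only the values near the origin
  matter; points are written \<open>(x, y)\<close>.\<close>

definition holomorphic_germ :: "(complex \<times> complex \<Rightarrow> complex) \<Rightarrow> bool" where
  "holomorphic_germ F \<longleftrightarrow>
     (\<exists>S. open S \<and> (0, 0) \<in> S \<and>
        (\<forall>p\<in>S. \<exists>a b. (F has_derivative (\<lambda>(h, k). a * h + b * k)) (at p)))"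

definition unit_germ :: "(complex \<times> complex \<Rightarrow> complex) \<Rightarrow> bool" where
  "unit_germ u \<longleftrightarrow> holomorphic_germ u \<and> u (0, 0) \<noteq> 0"

definition partial_x :: "(complex \<times> complex \<Rightarrow> complex) \<Rightarrow> complex \<times> complex \<Rightarrow> complex" where
  "partial_x F = (\<lambda>(x, y). deriv (\<lambda>x'. F (x', y)) x)"

definition partial_y :: "(complex \<times> complex \<Rightarrow> complex) \<Rightarrow> complex \<times> complex \<Rightarrow> complex" where
  "partial_y F = (\<lambda>(x, y). deriv (\<lambda>y'. F (x, y')) y)"

definition jacobian ::
  "(complex \<times> complex \<Rightarrow> complex) \<Rightarrow> (complex \<times> complex \<Rightarrow> complex) \<Rightarrow> complex \<times> complex \<Rightarrow> complex"
  where
  "jacobian f g = (\<lambda>p. partial_y f p * partial_x g p - partial_x f p * partial_y g p)"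

text \<open>\<open>along F c\<close> is the fractional power series \<open>F(c(y), y)\<close>: put \<open>y = t\<^sup>n\<close>, expand at \<open>t = 0\<close>,
  and go back to \<open>y\<close>. The result does not depend on the choice of an admissible \<open>n\<close>.\<close>

definition ramification :: "frac_series \<Rightarrow> nat" where
  "ramification c = (LEAST n. ramified n c)"

definition along :: "(complex \<times> complex \<Rightarrow> complex) \<Rightarrow> frac_series \<Rightarrow> frac_series" where
  "along F c =
     (let n = ramification c
      in of_fps n (fps_expansion (\<lambda>t. F (eval_fps (to_fps n c) t, t ^ n)) 0))"

text \<open>
  \<open>F = u y\<^sup>E \<Prod>\<^sub>\<alpha> (x - \<alpha>(y))\<close>, where \<open>\<alpha>\<close> ranges over the finite set \<open>R\<close>. The identity is
  expressed in \<open>(x, t)\<close> with \<open>y = t\<^sup>n\<close> for a common denominator \<open>n\<close> of the exponents. The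
  roots are given as a set because they are pairwise distinct.
\<close>

definition newton_puiseux ::
  "(complex \<times> complex \<Rightarrow> complex) \<Rightarrow> (complex \<times> complex \<Rightarrow> complex) \<Rightarrow> nat \<Rightarrow> frac_series set \<Rightarrow> bool"
  where
  "newton_puiseux F u E R \<longleftrightarrow>
     unit_germ u \<and> finite R \<and> (\<forall>\<alpha>\<in>R. puiseux_arc \<alpha> \<and> ord_y \<alpha> > 0) \<and>
     (\<exists>n>0. (\<forall>\<alpha>\<in>R. ramified n \<alpha>) \<and>
        (\<forall>\<^sub>F (x, t) in nhds (0, 0).
           F (x, t ^ n) = u (x, t ^ n) * (t ^ n) ^ E * (\<Prod>\<alpha>\<in>R. x - eval_fps (to_fps n \<alpha>) t)))"

definition polar_root ::
  "(complex \<times> complex \<Rightarrow> complex) \<Rightarrow> (complex \<times> complex \<Rightarrow> complex) \<Rightarrow> frac_series \<Rightarrow> bool"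
  where
  "polar_root f g \<gamma> \<longleftrightarrow>
     puiseux_arc \<gamma> \<and> ord_y \<gamma> > 0 \<and>
     along (jacobian f g) \<gamma> = (\<lambda>_. 0) \<and> along (\<lambda>p. f p * g p) \<gamma> \<noteq> (\<lambda>_. 0)"


section \<open>The tree\<close>

text \<open>
  A bar is recorded by the set of roots lying in the trunk below it, equivalently in the trunks
  growing on it, together with its (finite) height. For the ground bar this is the set of all
  roots and height 0; since all roots have positive order, it carries the main trunk only.
\<close>

datatype bar = Bar (members: "frac_series set") (height: real)

definition trunks :: "bar \<Rightarrow> frac_series set set" where
  "trunks B = {{\<mu>\<in>members B. contact \<xi> \<mu> > ereal (height B)} | \<xi>. \<xi> \<in> members B}"

definition trunk_height :: "frac_series set \<Rightarrow> ereal" where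
  "trunk_height T = Inf {contact \<xi> \<mu> | \<xi> \<mu>. \<xi> \<in> T \<and> \<mu> \<in> T \<and> \<xi> \<noteq> \<mu>}"

inductive is_bar :: "frac_series set \<Rightarrow> bar \<Rightarrow> bool" for \<Lambda> where
  ground: "is_bar \<Lambda> (Bar \<Lambda> 0)"
| on_top: "\<lbrakk>is_bar \<Lambda> B; T \<in> trunks B; trunk_height T = ereal h\<rbrakk> \<Longrightarrow> is_bar \<Lambda> (Bar T h)"

text \<open>\<open>stem B\<close> is the series \<open>\<lambda>\<^sub>B\<close>, common to all members of \<open>B\<close>.\<close>

definition stem :: "bar \<Rightarrow> frac_series" where
  "stem B = (\<lambda>e. if e < height B then (SOME \<xi>. \<xi> \<in> members B) e else 0)"

definition climbs_over_at :: "frac_series \<Rightarrow> bar \<Rightarrow> complex \<Rightarrow> bool" where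
  "climbs_over_at \<xi> B a \<longleftrightarrow> (\<forall>e<height B. \<xi> e = stem B e) \<and> \<xi> (height B) = a"

definition climbs_over :: "frac_series \<Rightarrow> bar \<Rightarrow> bool" where
  "climbs_over \<xi> B \<longleftrightarrow> (\<exists>a. climbs_over_at \<xi> B a)"

definition grows_at :: "frac_series set \<Rightarrow> bar \<Rightarrow> complex \<Rightarrow> bool" where
  "grows_at T B c \<longleftrightarrow> T \<in> trunks B \<and> (\<forall>\<xi>\<in>T. climbs_over_at \<xi> B c)"

definition growth_points :: "bar \<Rightarrow> complex set" where
  "growth_points B = {c. \<exists>T. grows_at T B c}"

definition trunk_at :: "bar \<Rightarrow> complex \<Rightarrow> frac_series set" where
  "trunk_at B c = (THE T. grows_at T B c)"

definition is_postbar :: "bar \<Rightarrow> complex \<Rightarrow> bar \<Rightarrow> bool" where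
  "is_postbar B c B' \<longleftrightarrow>
     grows_at (members B') B c \<and> trunk_height (members B') = ereal (height B')"


section \<open>The rational function of a bar\<close>

text \<open>
  Generic values of \<open>z\<close>. At height 0 the arc \<open>\<lambda>\<^sub>B + z y\<^bsup>h(B)\<^esup>\<close> is the constant \<open>z\<close>, along which
  a germ at the origin can be evaluated only for \<open>z\<close> close to 0.
\<close>

definition generic :: "bar \<Rightarrow> complex filter" where
  "generic B = (if height B = 0 then at 0 else cofinite)"

definition nu :: "(complex \<times> complex \<Rightarrow> complex) \<Rightarrow> bar \<Rightarrow> real" where
  "nu F B = (THE v. \<forall>\<^sub>F z in generic B.
     ord_y (along F (\<lambda>e. stem B e + (if e = height B then z else 0))) = ereal v)"

text \<open>In the following \<open>P\<close> and \<open>Q\<close> are the sets of roots of \<open>f\<close> and \<open>g\<close>, so that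
  \<open>[card (T \<inter> P), card (T \<inter> Q)]\<close> is the bimultiplicity of a trunk \<open>T\<close>.\<close>

definition Delta ::
  "(complex \<times> complex \<Rightarrow> complex) \<Rightarrow> (complex \<times> complex \<Rightarrow> complex) \<Rightarrow>
   frac_series set \<Rightarrow> frac_series set \<Rightarrow> bar \<Rightarrow> complex \<Rightarrow> real" where
  "Delta f g P Q B c =
     nu f B * real (card (trunk_at B c \<inter> Q)) - nu g B * real (card (trunk_at B c \<inter> P))"

definition ratfun ::
  "(complex \<times> complex \<Rightarrow> complex) \<Rightarrow> (complex \<times> complex \<Rightarrow> complex) \<Rightarrow>
   frac_series set \<Rightarrow> frac_series set \<Rightarrow> bar \<Rightarrow> complex \<Rightarrow> complex" where
  "ratfun f g P Q B z = (\<Sum>c\<in>growth_points B. of_real (Delta f g P Q B c) / (z - c))"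

definition noncollinear_points ::
  "(complex \<times> complex \<Rightarrow> complex) \<Rightarrow> (complex \<times> complex \<Rightarrow> complex) \<Rightarrow>
   frac_series set \<Rightarrow> frac_series set \<Rightarrow> bar \<Rightarrow> complex set" where
  "noncollinear_points f g P Q B = {c\<in>growth_points B. Delta f g P Q B c \<noteq> 0}"

definition noncollinear ::
  "(complex \<times> complex \<Rightarrow> complex) \<Rightarrow> (complex \<times> complex \<Rightarrow> complex) \<Rightarrow>
   frac_series set \<Rightarrow> frac_series set \<Rightarrow> bar \<Rightarrow> bool" where
  "noncollinear f g P Q B \<longleftrightarrow> noncollinear_points f g P Q B \<noteq> {}"

definition num_noncollinear ::
  "(complex \<times> complex \<Rightarrow> complex) \<Rightarrow> (complex \<times> complex \<Rightarrow> complex) \<Rightarrow>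
   frac_series set \<Rightarrow> frac_series set \<Rightarrow> bar \<Rightarrow> nat" where
  "num_noncollinear f g P Q B = card (noncollinear_points f g P Q B)"

text \<open>Meaningful for noncollinear \<open>B\<close> only. Zeros are selected by a positive \<open>zorder\<close>, since
  division by zero may give \<open>ratfun\<close> the value 0 at one of its poles.\<close>

definition num_zeros ::
  "(complex \<times> complex \<Rightarrow> complex) \<Rightarrow> (complex \<times> complex \<Rightarrow> complex) \<Rightarrow>
   frac_series set \<Rightarrow> frac_series set \<Rightarrow> bar \<Rightarrow> nat" where
  "num_zeros f g P Q B =
     (\<Sum>z | zorder (ratfun f g P Q B) z > 0. nat (zorder (ratfun f g P Q B) z))"

end

theory Submission
  imports Defs "HOL-Computational_Algebra.Fundamental_Theorem_Algebra"
begin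

text \<open>
  Let \<open>T\<close> be the trunk that grows on \<open>B\<close> at \<open>z\<close> and carries \<open>B'\<close>, let \<open>[s, t]\<close> be its
  bimultiplicity, and fix a root \<open>\<xi>\<close> in \<open>T\<close>. For \<open>h(B) \<le> x \<le> h(B')\<close> let \<open>\<nu>\<^sub>f(x)\<close> be the order of
  \<open>f\<close> along an arc that follows \<open>\<xi>\<close> below height \<open>x\<close> and there separates from all roots. By the
  Newton-Puiseux factorisation this order is \<open>E\<^sub>1\<close> plus the sum of the contact orders of the arc
  with the roots of \<open>f\<close> (\<open>ord_y_along\<close>, \<open>nu_eq\<close>). When \<open>x\<close> grows, exactly the contacts with the
  members of \<open>T\<close> grow with it, so that \<open>\<nu>\<^sub>f(x) = \<nu>\<^sub>f(B) + s (x - h(B))\<close> and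
  \<open>\<nu>\<^sub>g(x) = \<nu>\<^sub>g(B) + t (x - h(B))\<close> (\<open>sum_truncated_contact_above_trunk\<close>). The products \<open>s t\<close> cancel in
  \<open>\<nu>\<^sub>f(x) t - \<nu>\<^sub>g(x) s = \<nu>\<^sub>f(B) t - \<nu>\<^sub>g(B) s = \<Delta>\<^sub>B(z) \<noteq> 0\<close>,
  and both claims are this invariance, read at different heights.

  At \<open>x = h(B')\<close> the left-hand side is the sum of the residues of the rational function of
  \<open>B'\<close>, because the trunks on \<open>B'\<close> partition \<open>T\<close>. A sum of \<open>m\<close> simple fractions with nonzero residues
  has a numerator of degree less than \<open>m\<close> that does not vanish at the poles, and whose coefficient
  in degree \<open>m - 1\<close> is the sum of the residues. As that sum is nonzero, there are \<open>m - 1\<close> zeros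
  (\<open>sum_zeros_partial_fractions\<close>).

  At \<open>h(B) < x = k < h(B')\<close> the invariance excludes a polar root \<open>\<gamma>\<close> that separates from \<open>\<xi>\<close> at
  height \<open>k\<close>. Put \<open>y = \<tau>\<^sup>n\<close>, and let \<open>\<phi>\<close> and \<open>\<psi>\<close> be the values of \<open>f\<close> and \<open>g\<close> along \<open>\<gamma>\<close>. By the
  chain rule \<open>\<phi>' g\<^sub>x - \<psi>' f\<^sub>x\<close> is a multiple of the Jacobian along \<open>\<gamma>\<close>, hence zero. Now
  \<open>\<tau> \<phi>' / \<phi>\<close> tends to \<open>n \<nu>\<^sub>f(k)\<close>. On the other hand, \<open>f\<^sub>x / f\<close> is, up to a holomorphic term, the sum of
  the \<open>1 / (\<gamma> - \<alpha>)\<close> over the roots \<open>\<alpha>\<close> of \<open>f\<close>; the members of \<open>T\<close> dominate this sum, and their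
  differences with \<open>\<gamma>\<close> have the same leading coefficient \<open>b\<close>, so that \<open>\<tau>\<^bsup>nk\<^esup> f\<^sub>x / f\<close> tends to
  \<open>s / b\<close>. Dividing \<open>\<phi>' g\<^sub>x = \<psi>' f\<^sub>x\<close> by \<open>\<phi> \<psi>\<close> and passing to the limit yields
  \<open>\<nu>\<^sub>f(k) t = \<nu>\<^sub>g(k) s\<close> (\<open>polar_root_balance\<close>), a contradiction.
\<close>

section \<open>Fractional power series and contact orders\<close>

lemma ramified_mult:
  assumes "ramified n c" and "m > 0"
  shows "ramified (n * m) c"
  unfolding ramified_def
proof (intro conjI allI impI)
  show "n * m > 0" using assms by (simp add: ramified_def)
  fix e assume "c e \<noteq> 0"
  then obtain k :: nat where "e = real k / real n"
    using assms by (auto simp: ramified_def)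
  then have "e = real (k * m) / real (n * m)" using assms(2) by simp
  then show "\<exists>k. e = real k / real (n * m)" by blast
qed

text \<open>
  Passing from the denominator \<open>n\<close> to \<open>n m\<close> substitutes \<open>t\<^sup>m\<close> for the parameter \<open>t\<close>, which spreads
  the coefficients out over the multiples of \<open>m\<close>.
\<close>
lemma fps_nth_to_fps_mult:
  assumes "ramified n c" and "m > 0"
  shows "fps_nth (to_fps (n * m) c) k = (if m dvd k then fps_nth (to_fps n c) (k div m) else 0)"
proof (cases "m dvd k")
  case True
  then show ?thesis using assms by (auto simp: to_fps_def elim!: dvdE)
next
  case False
  have "c (real k / real (n * m)) = 0"
  proof (rule ccontr)
    assume "c (real k / real (n * m)) \<noteq> 0"
    then obtain j :: nat where "real k / real (n * m) = real j / real n"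
      using assms by (auto simp: ramified_def)
    then have "real k = real (j * m)"
      using assms by (simp add: ramified_def field_simps)
    then have "k = j * m" by (simp only: of_nat_eq_iff)
    with False show False by simp
  qed
  then show ?thesis using False by (simp add: to_fps_def)
qed

lemma eval_to_fps_mult:
  assumes "ramified n c" and "m > 0"
  shows "eval_fps (to_fps (n * m) c) t = eval_fps (to_fps n c) (t ^ m)"
    and "summable (\<lambda>k. fps_nth (to_fps (n * m) c) k * t ^ k)
           \<longleftrightarrow> summable (\<lambda>k. fps_nth (to_fps n c) k * (t ^ m) ^ k)"
proof -
  let ?f = "\<lambda>k. fps_nth (to_fps (n * m) c) k * t ^ k"
  have mono: "strict_mono (\<lambda>k. m * k)" using assms(2) by (simp add: strict_mono_def)
  have zero: "?f k = 0" if "k \<notin> range (\<lambda>k. m * k)" for k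
    using that by (auto simp: fps_nth_to_fps_mult[OF assms] elim!: dvdE)
  have eq: "?f (m * k) = fps_nth (to_fps n c) k * (t ^ m) ^ k" for k
    using assms(2) by (simp add: fps_nth_to_fps_mult[OF assms] power_mult)
  show "eval_fps (to_fps (n * m) c) t = eval_fps (to_fps n c) (t ^ m)"
    using suminf_mono_reindex[OF mono, of ?f] zero by (simp add: eq eval_fps_def)
  show "summable ?f \<longleftrightarrow> summable (\<lambda>k. fps_nth (to_fps n c) k * (t ^ m) ^ k)"
    using summable_mono_reindex[OF mono, of ?f] zero by (simp add: eq)
qed

lemma fps_conv_radius_pos_iff:
  fixes A :: "complex fps"
  shows "fps_conv_radius A > 0 \<longleftrightarrow> (\<exists>t. t \<noteq> 0 \<and> summable (\<lambda>k. fps_nth A k * t ^ k))"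
proof
  assume "fps_conv_radius A > 0"
  then obtain r where r: "0 < ereal r" "ereal r < fps_conv_radius A"
    using ereal_dense2 zero_ereal_def by metis
  then have "summable (\<lambda>k. fps_nth A k * complex_of_real r ^ k)"
    by (intro summable_fps) auto
  then show "\<exists>t. t \<noteq> 0 \<and> summable (\<lambda>k. fps_nth A k * t ^ k)"
    using r by (intro exI[of _ "of_real r"]) auto
next
  assume "\<exists>t. t \<noteq> 0 \<and> summable (\<lambda>k. fps_nth A k * t ^ k)"
  then obtain t where t: "t \<noteq> 0" "summable (\<lambda>k. fps_nth A k * t ^ k)" by blast
  have "ereal (norm t) \<le> fps_conv_radius A"
    unfolding fps_conv_radius_def by (rule conv_radius_geI[OF t(2)])
  moreover have "0 < ereal (norm t)" using t by simp
  ultimately show "fps_conv_radius A > 0" by (rule less_le_trans[rotated])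
qed

lemma conv_radius_to_fps_mult:
  assumes "ramified n c" and "m > 0"
  shows "fps_conv_radius (to_fps (n * m) c) > 0 \<longleftrightarrow> fps_conv_radius (to_fps n c) > 0"
proof -
  have root: "\<exists>s. s \<noteq> 0 \<and> s ^ m = t" if "t \<noteq> 0" for t :: complex
    using that assms(2)
    by (intro exI[of _ "exp (ln t / of_nat m)"]) (simp flip: exp_of_nat_mult)
  show ?thesis
    unfolding fps_conv_radius_pos_iff eval_to_fps_mult(2)[OF assms]
  proof
    assume "\<exists>t. t \<noteq> 0 \<and> summable (\<lambda>k. fps_nth (to_fps n c) k * (t ^ m) ^ k)"
    then obtain t where "t \<noteq> 0" "summable (\<lambda>k. fps_nth (to_fps n c) k * (t ^ m) ^ k)" by blast
    then show "\<exists>t. t \<noteq> 0 \<and> summable (\<lambda>k. fps_nth (to_fps n c) k * t ^ k)"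
      by (intro exI[of _ "t ^ m"]) simp
  next
    assume "\<exists>t. t \<noteq> 0 \<and> summable (\<lambda>k. fps_nth (to_fps n c) k * t ^ k)"
    then obtain t where t: "t \<noteq> 0" "summable (\<lambda>k. fps_nth (to_fps n c) k * t ^ k)" by blast
    from root[OF t(1)] obtain s where "s \<noteq> 0" "s ^ m = t" by blast
    with t show "\<exists>t. t \<noteq> 0 \<and> summable (\<lambda>k. fps_nth (to_fps n c) k * (t ^ m) ^ k)"
      by (intro exI[of _ s]) simp
  qed
qed

text \<open>
  An arc is convergent for some denominator; a common multiple transfers this to every
  admissible one, in particular to the least one, on which \<open>along\<close> is based.
\<close>
lemma puiseux_arc_convergent:
  assumes "puiseux_arc c" and "ramified n c"
  shows "fps_conv_radius (to_fps n c) > 0"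
proof -
  obtain m where m: "ramified m c" "fps_conv_radius (to_fps m c) > 0"
    using assms(1) by (auto simp: puiseux_arc_def)
  have "fps_conv_radius (to_fps (m * n) c) > 0"
    using m assms(2) by (subst conv_radius_to_fps_mult) (auto simp: ramified_def)
  then show ?thesis
    using m assms(2) conv_radius_to_fps_mult[of n c m] by (simp add: ramified_def mult.commute)
qed

lemma ramified_ramification:
  assumes "ramified n c"
  shows "ramified (ramification c) c"
  unfolding ramification_def using assms by (rule LeastI)

lemma arc_has_fps_expansion:
  assumes "puiseux_arc c" and "ramified n c"
  shows "eval_fps (to_fps n c) has_fps_expansion to_fps n c"
  by (rule eval_fps_has_fps_expansion[OF puiseux_arc_convergent[OF assms]])

lemma to_fps_diff: "to_fps n (\<lambda>e. c e - d e) = to_fps n c - to_fps n d"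
  by (rule fps_ext) (simp add: to_fps_def)

lemma ramified_diff:
  "ramified n c \<Longrightarrow> ramified n d \<Longrightarrow> ramified n (\<lambda>e. c e - d e)"
  unfolding ramified_def by (metis diff_self)

lemma to_fps_eq_0_iff:
  assumes "ramified n c"
  shows "to_fps n c = 0 \<longleftrightarrow> c = (\<lambda>_. 0)"
proof
  assume A: "to_fps n c = 0"
  show "c = (\<lambda>_. 0)"
  proof (rule ccontr)
    assume "c \<noteq> (\<lambda>_. 0)"
    then obtain e where "c e \<noteq> 0" by auto
    moreover from this obtain k :: nat where "e = real k / real n"
      using assms by (auto simp: ramified_def)
    moreover have "fps_nth (to_fps n c) k = 0" using A by simp
    ultimately show False by (simp add: to_fps_def)
  qed
qed (auto simp: to_fps_def fps_eq_iff)

lemma ord_y_eq_subdegree: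
  assumes "ramified n c" and "c \<noteq> (\<lambda>_. 0)"
  shows "ord_y c = ereal (real (subdegree (to_fps n c)) / real n)"
proof -
  let ?k = "subdegree (to_fps n c)"
  have n: "n > 0" using assms by (simp add: ramified_def)
  have nz: "to_fps n c \<noteq> 0" using to_fps_eq_0_iff[OF assms(1)] assms(2) by simp
  have "c (real ?k / real n) \<noteq> 0"
    using nth_subdegree_nonzero[OF nz] by (simp add: to_fps_def)
  moreover have "real ?k / real n \<le> e" if e: "c e \<noteq> 0" for e
  proof -
    obtain j :: nat where j: "e = real j / real n"
      using assms e by (auto simp: ramified_def)
    then have "fps_nth (to_fps n c) j \<noteq> 0" using e by (simp add: to_fps_def)
    then have "?k \<le> j" by (rule subdegree_leI)
    then show ?thesis using j n by (simp add: divide_right_mono)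
  qed
  ultimately show ?thesis
    unfolding ord_y_def by (intro antisym INF_lower INF_greatest) auto
qed

lemma ramified_of_fps:
  assumes "n > 0"
  shows "ramified n (of_fps n A)"
  unfolding ramified_def of_fps_def
proof (intro conjI allI impI)
  fix e assume "(if e * real n \<in> \<nat> then fps_nth A (nat \<lfloor>e * real n\<rfloor>) else 0) \<noteq> 0"
  then have "e * real n \<in> \<nat>" by (auto split: if_splits)
  then obtain k where "e * real n = real k" by (auto elim: Nats_cases)
  then have "e = real k / real n" using assms by (simp add: field_simps)
  then show "\<exists>k. e = real k / real n" by blast
qed (rule assms)

lemma to_fps_of_fps: "n > 0 \<Longrightarrow> to_fps n (of_fps n A) = A"
  by (rule fps_ext) (simp add: to_fps_def of_fps_def)

lemma of_fps_eq_0_iff: "n > 0 \<Longrightarrow> of_fps n A = (\<lambda>_. 0) \<longleftrightarrow> A = 0"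
  using to_fps_eq_0_iff[OF ramified_of_fps[of n A]] to_fps_of_fps[of n A] by simp

lemma ord_y_of_fps:
  assumes "n > 0" and "A \<noteq> 0"
  shows "ord_y (of_fps n A) = ereal (real (subdegree A) / real n)"
  using ord_y_eq_subdegree[OF ramified_of_fps[OF assms(1), of A]] assms
  by (simp add: of_fps_eq_0_iff to_fps_of_fps)

lemma of_fps_nth: "e * real n = real k \<Longrightarrow> of_fps n A e = fps_nth A k"
  by (simp add: of_fps_def)

lemma of_fps_not_nth: "e * real n \<notin> \<nat> \<Longrightarrow> of_fps n A e = 0"
  by (simp add: of_fps_def)

text \<open>
  Together with \<open>eval_to_fps_mult\<close> this makes evaluation along an arc independent of the chosen
  denominator.
\<close>
lemma of_fps_compose_power:
  assumes "m > 0" and "n > 0"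
  shows "of_fps (n * m) (A oo fps_X ^ m) = of_fps n A"
proof
  fix e
  have assoc: "e * real (n * m) = (e * real n) * real m" by simp
  show "of_fps (n * m) (A oo fps_X ^ m) e = of_fps n A e"
  proof (cases "e * real n \<in> \<nat>")
    case True
    then obtain j where j: "e * real n = real j" by (auto elim: Nats_cases)
    then have "e * real (n * m) = real (j * m)" by (simp add: assoc)
    from of_fps_nth[OF this] of_fps_nth[OF j] show ?thesis
      using assms by (simp add: fps_nth_compose_X_power)
  next
    case False
    show ?thesis
    proof (cases "e * real (n * m) \<in> \<nat>")
      case True
      then obtain k where k: "e * real (n * m) = real k" by (auto elim: Nats_cases)
      have "\<not> m dvd k"
      proof
        assume "m dvd k"
        then obtain j where "k = m * j" by (auto elim: dvdE)
        then have "e * real n = real j" using k assms by (simp add: assoc)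
        with False show False by simp
      qed
      then show ?thesis
        using of_fps_nth[OF k] of_fps_not_nth[OF False] by (simp add: fps_nth_compose_X_power)
    qed (simp add: of_fps_not_nth False)
  qed
qed

lemma diff_fun_neq_0: "c \<noteq> d \<Longrightarrow> (\<lambda>e. c e - d e :: complex) \<noteq> (\<lambda>_. 0)"
  by (auto simp: fun_eq_iff)

lemma contact_eq_subdegree:
  assumes "ramified n c" and "ramified n d" and "c \<noteq> d"
  shows "contact c d = ereal (real (subdegree (to_fps n c - to_fps n d)) / real n)"
proof -
  show ?thesis
    using diff_fun_neq_0[OF assms(3)] ord_y_eq_subdegree[OF ramified_diff[OF assms(1,2)]] by (simp add: contact_def to_fps_diff)
qed

lemma contact_ge_iff: "ereal h \<le> contact c d \<longleftrightarrow> (\<forall>e<h. c e = d e)"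
proof
  assume "ereal h \<le> contact c d"
  then have "\<And>e. c e - d e \<noteq> 0 \<Longrightarrow> ereal h \<le> ereal e"
    unfolding contact_def ord_y_def by (meson INF_lower mem_Collect_eq order_trans)
  then show "\<forall>e<h. c e = d e" by (metis eq_iff_diff_eq_0 ereal_less_eq(3) not_less)
next
  assume *: "\<forall>e<h. c e = d e"
  show "ereal h \<le> contact c d"
    unfolding contact_def ord_y_def
  proof (rule INF_greatest)
    fix e assume "e \<in> {e. c e - d e \<noteq> 0}"
    then show "ereal h \<le> ereal e" using * by (metis (mono_tags) eq_iff_diff_eq_0 ereal_less_eq(3) mem_Collect_eq not_less)
  qed
qed

lemma contact_le: "c e \<noteq> d e \<Longrightarrow> contact c d \<le> ereal e"
  unfolding contact_def ord_y_def by (rule INF_lower) simp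

lemma contact_self [simp]: "contact c c = \<infinity>"
  by (simp add: contact_def ord_y_def top_ereal_def)

lemma contact_commute: "contact c d = contact d c"
  unfolding contact_def ord_y_def by (intro INF_cong) auto

text \<open>
  If \<open>a\<close> and \<open>c\<close> differ at some exponent, then \<open>b\<close> differs there from one of the two.
\<close>
lemma contact_ultrametric: "min (contact a b) (contact b c) \<le> contact a c"
  unfolding contact_def[of a c] ord_y_def
proof (rule INF_greatest)
  fix e assume "e \<in> {e. a e - c e \<noteq> 0}"
  then have "a e \<noteq> b e \<or> b e \<noteq> c e" by auto
  then show "min (contact a b) (contact b c) \<le> ereal e"
    using contact_le[of a e b] contact_le[of b e c] by (auto simp: min_le_iff_disj)
qed

lemma contact_agree_upto:
  assumes "\<forall>e<h. c e = d e" and "contact d a < ereal h"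
  shows "contact c a = contact d a"
proof -
  have cd: "contact c d \<ge> ereal h" using assms by (simp add: contact_ge_iff)
  have "min (contact c d) (contact d a) = contact d a"
    using cd assms(2) by (intro min_absorb2) (simp add: less_imp_le)
  then have ge: "contact d a \<le> contact c a" using contact_ultrametric[of c d a] by simp
  have "min (contact d c) (contact c a) \<le> contact d a" by (rule contact_ultrametric)
  moreover have "contact d a < contact d c" 
    using cd assms(2) by (simp add: contact_commute[of d c])
  ultimately have "contact c a \<le> contact d a" by (auto simp: min_le_iff_disj)
  with ge show ?thesis by simp
qed

text \<open>
  An arc that follows \<open>d\<close> below \<open>h\<close> and has at \<open>h\<close> a coefficient foreign to \<open>a\<close> inherits the
  contact of \<open>d\<close> with \<open>a\<close>, truncated at \<open>h\<close>. This evaluates orders along generic arcs over a bar and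
  along polar roots alike.
\<close>
lemma contact_branching:
  assumes "\<forall>e<h. c e = d e" and "c h \<noteq> a h"
  shows "contact c a = min (ereal h) (contact d a)"
proof (cases "contact d a < ereal h")
  case True
  then show ?thesis using contact_agree_upto[OF assms(1) True] by (simp add: min_absorb2 less_imp_le)
next
  case False
  then have "\<forall>e<h. d e = a e" using contact_ge_iff by (simp add: not_less)
  then have "ereal h \<le> contact c a" using assms(1) by (simp add: contact_ge_iff)
  then have "contact c a = ereal h" using contact_le[of c h a] assms(2) by simp
  then show ?thesis using False by (simp add: min_absorb1 not_less)
qed

text \<open>
  The exponents of ramified series are discrete: if two of them agree up to and including \<open>h\<close>, the
  exponents at which they differ stay away from \<open>h\<close>.
\<close>
lemma contact_gt_iff:
  assumes "ramified n c" and "ramified n d" and "\<forall>e<h. c e = d e"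
  shows "ereal h < contact c d \<longleftrightarrow> c h = d h"
proof (cases "c = d")
  case False
  let ?k = "subdegree (to_fps n c - to_fps n d)"
  have eq: "contact c d = ereal (real ?k / real n)"
    by (rule contact_eq_subdegree[OF assms(1,2) False])
  have "to_fps n c - to_fps n d \<noteq> 0"
    using to_fps_eq_0_iff[OF ramified_diff[OF assms(1,2)]] diff_fun_neq_0[OF False]
    by (simp add: to_fps_diff)
  from nth_subdegree_nonzero[OF this] have "c (real ?k / real n) \<noteq> d (real ?k / real n)"
    by (simp add: to_fps_def)
  then have "real ?k / real n \<noteq> h" if "c h = d h" using that by auto
  moreover have "h \<le> real ?k / real n" using assms(3) eq contact_ge_iff[of h c d] by simp
  moreover have "real ?k / real n \<le> h" if "c h \<noteq> d h" using contact_le[of c h d] that eq by simp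
  ultimately show ?thesis unfolding eq by (auto simp: order_less_le)
qed auto

lemma contact_attained:
  assumes "ramified n c" "ramified n d" "contact c d = ereal k"
  shows "c k \<noteq> d k"
proof -
  have "\<forall>e<k. c e = d e" using contact_ge_iff[of k c d] assms(3) by simp
  from contact_gt_iff[OF assms(1,2) this] assms(3) show ?thesis by simp
qed

lemma ord_y_pos_imp:
  assumes "ord_y c > 0" and "e \<le> 0"
  shows "c e = 0"
proof (rule ccontr)
  assume "c e \<noteq> 0"
  then have "ord_y c \<le> ereal e" unfolding ord_y_def by (intro INF_lower) simp
  also have "\<dots> \<le> 0" using assms(2) by simp
  finally show False using assms(1) by simp
qed

text \<open>
  The contact with \<open>\<alpha>\<close> of an arc that follows \<open>\<xi>\<close> below \<open>x\<close> and there separates from \<open>\<alpha>\<close>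
  (\<open>contact_branching\<close>). It is finite even if \<open>\<alpha> = \<xi>\<close>.
\<close>
definition truncated_contact :: "frac_series \<Rightarrow> real \<Rightarrow> frac_series \<Rightarrow> real" where
  "truncated_contact \<xi> x \<alpha> = real_of_ereal (min (ereal x) (contact \<xi> \<alpha>))"


section \<open>Holomorphic functions of two variables along curves\<close>

definition holomorphic2_on :: "(complex \<times> complex \<Rightarrow> complex) \<Rightarrow> (complex \<times> complex) set \<Rightarrow> bool" where
  "holomorphic2_on F S \<longleftrightarrow> open S \<and>
     (\<forall>p\<in>S. \<exists>a b. (F has_derivative (\<lambda>(h, k). a * h + b * k)) (at p))"

lemma holomorphic_germ_iff: "holomorphic_germ F \<longleftrightarrow> (\<exists>S. holomorphic2_on F S \<and> (0, 0) \<in> S)"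
  by (auto simp: holomorphic_germ_def holomorphic2_on_def)

lemma holomorphic2_on_subset:
  "holomorphic2_on F S \<Longrightarrow> open T \<Longrightarrow> T \<subseteq> S \<Longrightarrow> holomorphic2_on F T"
  by (auto simp: holomorphic2_on_def)

lemma holomorphic2_on_has_derivative:
  assumes "holomorphic2_on F S" and "p \<in> S"
  shows "(F has_derivative (\<lambda>(h, k). partial_x F p * h + partial_y F p * k)) (at p)"
proof -
  obtain x y where p: "p = (x, y)" by force
  obtain a b where ab: "(F has_derivative (\<lambda>(h, k). a * h + b * k)) (at (x, y))"
    using assms unfolding holomorphic2_on_def p by blast
  have "((\<lambda>x'. F (x', y)) has_derivative (\<lambda>h. case (h, 0) of (h, k) \<Rightarrow> a * h + b * k)) (at x)"
    by (rule has_derivative_compose[where f = "\<lambda>x'. (x', y)" and f' = "\<lambda>h. (h, 0)"])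
      (auto intro!: derivative_eq_intros ab)
  then have "((\<lambda>x'. F (x', y)) has_field_derivative a) (at x)"
    by (simp add: has_field_derivative_def)
  then have a: "partial_x F p = a" by (simp add: p partial_x_def DERIV_imp_deriv)
  have "((\<lambda>y'. F (x, y')) has_derivative (\<lambda>k. case (0, k) of (h, k) \<Rightarrow> a * h + b * k)) (at y)"
    by (rule has_derivative_compose[where f = "\<lambda>y'. (x, y')" and f' = "\<lambda>k. (0, k)"])
      (auto intro!: derivative_eq_intros ab)
  then have "((\<lambda>y'. F (x, y')) has_field_derivative b) (at y)"
    by (simp add: has_field_derivative_def)
  then have b: "partial_y F p = b" by (simp add: p partial_y_def DERIV_imp_deriv)
  show ?thesis using ab unfolding p a[unfolded p] b[unfolded p] .
qed

lemma holomorphic2_on_chain_rule: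
  assumes "holomorphic2_on F S" and "(A t, C t) \<in> S"
    and "(A has_field_derivative A') (at t)" and "(C has_field_derivative C') (at t)"
  shows "((\<lambda>t. F (A t, C t)) has_field_derivative
           partial_x F (A t, C t) * A' + partial_y F (A t, C t) * C') (at t)"
proof -
  have "((\<lambda>t. (A t, C t)) has_derivative (\<lambda>h. (A' * h, C' * h))) (at t)"
    using assms(3,4) by (auto simp: has_field_derivative_def intro!: derivative_eq_intros)
  from has_derivative_compose[OF this holomorphic2_on_has_derivative[OF assms(1,2)]]
  show ?thesis
    unfolding has_field_derivative_def
    by (rule has_derivative_eq_rhs) (simp add: fun_eq_iff algebra_simps)
qed

lemma holomorphic2_on_imp_continuous_on: "holomorphic2_on F S \<Longrightarrow> continuous_on S F"
  by (meson continuous_at_imp_continuous_on has_derivative_continuous holomorphic2_on_has_derivative)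

lemma holomorphic2_on_slice:
  assumes "holomorphic2_on F S" and "\<And>x. x \<in> T \<Longrightarrow> (A x, C x) \<in> S"
    and "A holomorphic_on T" "C holomorphic_on T" and "open T"
  shows "(\<lambda>x. F (A x, C x)) holomorphic_on T"
proof -
  have "\<exists>d. ((\<lambda>x. F (A x, C x)) has_field_derivative d) (at x)" if "x \<in> T" for x
    using holomorphic2_on_chain_rule[where A = A and C = C, OF assms(1) assms(2)[OF that]]
      holomorphic_derivI[OF assms(3,5) that] holomorphic_derivI[OF assms(4,5) that] by blast
  then show ?thesis using assms(5) by (auto simp: holomorphic_on_open)
qed

lemma analytic_at_curve_near:
  assumes "A analytic_on {0}" "C analytic_on {0}" and "open S" "(A 0, C 0) \<in> S"
  obtains d where "d > 0" "A holomorphic_on ball 0 d" "C holomorphic_on ball 0 d"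
    "\<And>t. t \<in> ball 0 d \<Longrightarrow> (A t, C t) \<in> S"
proof -
  obtain U where U: "open U" "(0::complex) \<in> U" "A holomorphic_on U" "C holomorphic_on U"
    using assms(1,2) analytic_at_two by metis
  have "continuous_on U (\<lambda>t. (A t, C t))"
    using U by (intro continuous_intros holomorphic_on_imp_continuous_on)
  then have "open (U \<inter> (\<lambda>t. (A t, C t)) -` S)"
    using U assms(3) by (simp add: continuous_on_open_vimage Int_commute)
  moreover have "0 \<in> U \<inter> (\<lambda>t. (A t, C t)) -` S" using U assms(4) by simp
  ultimately obtain d where d: "d > 0" "ball 0 d \<subseteq> U \<inter> (\<lambda>t. (A t, C t)) -` S"
    using open_contains_ball by blast
  show ?thesis
    using d U by (intro that[of d]) (auto elim: holomorphic_on_subset)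
qed

lemma holomorphic2_on_analytic_along:
  assumes "holomorphic2_on F S" "(A 0, C 0) \<in> S" "A analytic_on {0}" "C analytic_on {0}"
  shows "(\<lambda>t. F (A t, C t)) analytic_on {0}"
proof -
  obtain d where d: "d > 0" "A holomorphic_on ball 0 d" "C holomorphic_on ball 0 d"
    "\<And>t. t \<in> ball 0 d \<Longrightarrow> (A t, C t) \<in> S"
    using analytic_at_curve_near assms unfolding holomorphic2_on_def by metis
  then have "(\<lambda>t. F (A t, C t)) holomorphic_on ball 0 d"
    by (intro holomorphic2_on_slice[OF assms(1)]) auto
  then show ?thesis using d(1) unfolding analytic_at by (intro exI[of _ "ball 0 d"]) simp
qed

text \<open>
  Taylor's formula of order one, with the second derivative controlled by Cauchy's inequality.
  The bound depends on \<open>h\<close> only through \<open>M\<close>, which makes it uniform in families.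
\<close>
lemma difference_quotient_bound:
  assumes hol: "h holomorphic_on ball a (3 * r)" and M: "\<And>w. w \<in> ball a (3 * r) \<Longrightarrow> norm (h w) < M"
    and x: "x \<in> ball a r" and \<delta>: "\<delta> \<noteq> 0" "norm \<delta> < r"
  shows "norm ((h (x + \<delta>) - h x) / \<delta> - deriv h x) \<le> 2 * M / r ^ 2 * norm \<delta>"
proof -
  have r: "r > 0" using \<delta> by (smt (verit) norm_ge_zero)
  have bound: "norm ((deriv ^^ 2) h w) \<le> 2 * M / r ^ 2" if w: "w \<in> ball a (2 * r)" for w
  proof -
    have sub: "cball w r \<subseteq> ball a (3 * r)"
    proof
      fix v assume "v \<in> cball w r"
      then have "dist a v \<le> dist a w + r" using dist_triangle[of a v w] by simp
      then show "v \<in> ball a (3 * r)" using w by simp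
    qed
    have "norm ((deriv ^^ 2) h w) \<le> fact 2 * M / r ^ 2"
    proof (rule Cauchy_higher_deriv_bound[where y = 0])
      show "h holomorphic_on ball w r"
        using hol sub ball_subset_cball by (meson holomorphic_on_subset order_trans)
      show "continuous_on (cball w r) h"
        using hol sub by (meson continuous_on_subset holomorphic_on_imp_continuous_on)
      show "h v \<in> ball 0 M" if "v \<in> ball w r" for v
        using M sub that ball_subset_cball by (auto simp: subset_iff)
    qed (use r in auto)
    then show ?thesis by (simp add: fact_numeral)
  qed
  have deriv: "((deriv ^^ i) h has_field_derivative (deriv ^^ Suc i) h w) (at w within ball a (2 * r))"
    if "w \<in> ball a (2 * r)" for i w
  proof -
    have "(deriv ^^ i) h holomorphic_on ball a (3 * r)"
      using hol by (simp add: holomorphic_higher_deriv)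
    moreover have "w \<in> ball a (3 * r)" using that r by auto
    ultimately show ?thesis
      by (auto intro: holomorphic_derivI has_field_derivative_at_within)
  qed
  have "x + \<delta> \<in> ball a (2 * r)"
    using x \<delta> dist_triangle[of a "x + \<delta>" x] by (simp add: dist_norm)
  moreover have "x \<in> ball a (2 * r)" using x r by auto
  ultimately have "norm ((deriv ^^ 0) h (x + \<delta>)
      - (\<Sum>i\<le>1. (deriv ^^ i) h x * (x + \<delta> - x) ^ i / fact i))
      \<le> 2 * M / r ^ 2 * norm (x + \<delta> - x) ^ Suc 1 / fact 1"
    by (intro field_Taylor[of "ball a (2 * r)" 1 "\<lambda>i. (deriv ^^ i) h"])
      (use bound deriv in \<open>auto simp: numeral_2_eq_2\<close>)
  then have T: "norm (h (x + \<delta>) - h x - deriv h x * \<delta>) \<le> 2 * M / r ^ 2 * (norm \<delta> * norm \<delta>)"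
    by (simp add: diff_diff_eq power2_eq_square)
  have "(h (x + \<delta>) - h x) / \<delta> - deriv h x = (h (x + \<delta>) - h x - deriv h x * \<delta>) / \<delta>"
    using \<delta> by (simp add: field_simps)
  then have "norm ((h (x + \<delta>) - h x) / \<delta> - deriv h x)
      = norm (h (x + \<delta>) - h x - deriv h x * \<delta>) / norm \<delta>"
    by (simp add: norm_divide)
  also have "\<dots> \<le> 2 * M / r ^ 2 * (norm \<delta> * norm \<delta>) / norm \<delta>"
    by (rule divide_right_mono[OF T]) simp
  also have "\<dots> = 2 * M / r ^ 2 * norm \<delta>" using \<delta> by simp
  finally show ?thesis .
qed

text \<open>
  The difference quotients in the \<open>x\<close>-direction are analytic along the curve, and by
  \<open>difference_quotient_bound\<close> they converge uniformly near \<open>0\<close>. A germ is only required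
  to be differentiable, so the continuity of its partial derivatives has to be a consequence.
\<close>
lemma partial_x_analytic_along:
  assumes F: "holomorphic2_on F S" and p: "(A 0, C 0) \<in> S"
    and A: "A analytic_on {0}" and C: "C analytic_on {0}"
  shows "(\<lambda>t. partial_x F (A t, C t)) analytic_on {0}"
proof -
  have "open S" using F by (simp add: holomorphic2_on_def)
  then obtain e where e: "e > 0" "cball (A 0, C 0) e \<subseteq> S"
    using p open_contains_cball by blast
  \<comment> \<open>Then a disc of radius \<open>3 r\<close> times a disc of radius \<open>r\<close> fits into the ball of radius \<open>e\<close>.\<close>
  define r where "r = e / 4"
  have r: "r > 0" using e by (simp add: r_def)
  have box: "(x, y) \<in> cball (A 0, C 0) e" if "x \<in> ball (A 0) (3 * r)" "y \<in> ball (C 0) r" for x y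
  proof -
    have "dist (A 0, C 0) (x, y) \<le> dist (A 0) x + dist (C 0) y"
      unfolding dist_Pair_Pair by (rule order_trans[OF sqrt_sum_squares_le_sum_abs]) simp
    also have "\<dots> \<le> e" using that by (simp add: r_def)
    finally show ?thesis by simp
  qed
  have "compact (F ` cball (A 0, C 0) e)"
    using holomorphic2_on_imp_continuous_on[OF F] e
    by (intro compact_continuous_image) (auto elim: continuous_on_subset)
  then obtain M where M: "\<forall>w\<in>F ` cball (A 0, C 0) e. norm w < M"
    using compact_imp_bounded bounded_pos_less by metis
  have "open (ball (A 0) r \<times> ball (C 0) r)" by (simp add: open_Times)
  moreover have "(A 0, C 0) \<in> ball (A 0) r \<times> ball (C 0) r" using r by simp
  ultimately obtain d where d: "d > 0" "A holomorphic_on ball 0 d" "C holomorphic_on ball 0 d"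
    and AC: "\<And>t. t \<in> ball 0 d \<Longrightarrow> (A t, C t) \<in> ball (A 0) r \<times> ball (C 0) r"
    using analytic_at_curve_near[OF A C] by metis
  \<comment> \<open>The offset \<open>2\<close> makes \<open>\<delta> n\<close> smaller than \<open>r\<close>, as \<open>difference_quotient_bound\<close> requires.\<close>
  define \<delta> :: "nat \<Rightarrow> complex" where "\<delta> n = of_real (r / real (n + 2))" for n
  have \<delta>: "\<delta> n \<noteq> 0" "norm (\<delta> n) < r" for n
  proof -
    have "norm (\<delta> n) = r / real (n + 2)" using r unfolding \<delta>_def norm_of_real by simp
    moreover have "0 < r / real (n + 2)" "r / real (n + 2) < r"
      using r by (auto simp: field_simps intro: add_pos_nonneg)
    ultimately show "\<delta> n \<noteq> 0" "norm (\<delta> n) < r" by (auto simp del: of_nat_add)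
  qed
  have near: "A t + \<delta> n \<in> ball (A 0) (3 * r)" "A t \<in> ball (A 0) (3 * r)" if "t \<in> ball 0 d" for t n
  proof -
    have "dist (A 0) (A t + \<delta> n) \<le> dist (A 0) (A t) + norm (\<delta> n)"
      using dist_triangle[of "A 0" "A t + \<delta> n" "A t"] by (simp add: dist_norm)
    then show "A t + \<delta> n \<in> ball (A 0) (3 * r)" using AC[OF that] \<delta>[of n] r by auto
    show "A t \<in> ball (A 0) (3 * r)" using AC[OF that] r by auto
  qed
  define D where "D n t = (F (A t + \<delta> n, C t) - F (A t, C t)) / \<delta> n" for n t
  have holD: "D n holomorphic_on ball 0 d" for n
    unfolding D_def
  proof (intro holomorphic_intros holomorphic2_on_slice[OF F])
    show "(A t + \<delta> n, C t) \<in> S" if "t \<in> ball 0 d" for t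
      using box near(1)[OF that] AC[OF that] e by blast
    show "(A t, C t) \<in> S" if "t \<in> ball 0 d" for t
      using box near(2)[OF that] AC[OF that] e by blast
  qed (use d \<delta> in auto)
  have bound: "norm (D n t - partial_x F (A t, C t)) \<le> 2 * M / r ^ 2 * norm (\<delta> n)"
    if t: "t \<in> ball 0 d" for n t
  proof -
    have Ct: "C t \<in> ball (C 0) r" and At: "A t \<in> ball (A 0) r" using AC[OF t] by auto
    have "(\<lambda>x. F (x, C t)) holomorphic_on ball (A 0) (3 * r)"
      by (rule holomorphic2_on_slice[OF F]) (use box Ct e in auto)
    then have "norm ((F (A t + \<delta> n, C t) - F (A t, C t)) / \<delta> n - deriv (\<lambda>x. F (x, C t)) (A t))
       \<le> 2 * M / r ^ 2 * norm (\<delta> n)"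
      by (rule difference_quotient_bound) (use M box Ct At \<delta> in auto)
    then show ?thesis by (simp add: D_def partial_x_def)
  qed
  have lim: "(\<lambda>n. 2 * M / r ^ 2 * norm (\<delta> n)) \<longlonglongrightarrow> 0"
  proof -
    have "(\<lambda>n. 2 * M / r ^ 2 * (r / real (n + 2))) \<longlonglongrightarrow> 2 * M / r ^ 2 * 0"
      by (intro tendsto_mult tendsto_const) (rule LIMSEQ_ignore_initial_segment[OF lim_const_over_n])
    then show ?thesis using r unfolding \<delta>_def norm_of_real by simp
  qed
  have "(\<lambda>t. partial_x F (A t, C t)) holomorphic_on ball 0 d"
  proof (rule holomorphic_uniform_sequence[OF _ holD])
    fix t :: complex assume "t \<in> ball 0 d"
    then obtain s where s: "s > 0" "cball t s \<subseteq> ball 0 d"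
      using open_contains_cball open_ball by blast
    have "uniform_limit (cball t s) D (\<lambda>t. partial_x F (A t, C t)) sequentially"
    proof (rule uniform_limitI)
      fix \<epsilon> :: real assume "\<epsilon> > 0"
      with lim have "\<forall>\<^sub>F n in sequentially. 2 * M / r ^ 2 * norm (\<delta> n) < \<epsilon>"
        by (rule order_tendstoD(2))
      then show "\<forall>\<^sub>F n in sequentially. \<forall>w\<in>cball t s. dist (D n w) (partial_x F (A w, C w)) < \<epsilon>"
      proof eventually_elim
        case (elim n)
        show ?case
        proof
          fix w assume "w \<in> cball t s"
          then have "dist (D n w) (partial_x F (A w, C w)) \<le> 2 * M / r ^ 2 * norm (\<delta> n)"
            using bound[of w n] s(2) by (auto simp: dist_norm)
          then show "dist (D n w) (partial_x F (A w, C w)) < \<epsilon>" using elim by linarith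
        qed
      qed
    qed
    with s show "\<exists>s>0. cball t s \<subseteq> ball 0 d \<and>
      uniform_limit (cball t s) D (\<lambda>t. partial_x F (A t, C t)) sequentially" by blast
  qed simp
  then show ?thesis using d(1) unfolding analytic_at by (intro exI[of _ "ball 0 d"]) simp
qed

lemma partial_y_analytic_along:
  assumes F: "holomorphic2_on F S" and p: "(A 0, C 0) \<in> S"
    and "A analytic_on {0}" and "C analytic_on {0}"
  shows "(\<lambda>t. partial_y F (A t, C t)) analytic_on {0}"
proof -
  have swap: "(prod.swap has_derivative prod.swap) (at (q :: complex \<times> complex))" for q
    by (intro bounded_linear_imp_has_derivative bounded_linear_intro[where K = 1])
      (auto simp: norm_Pair add.commute)
  have "holomorphic2_on (F \<circ> prod.swap) (prod.swap -` S)"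
    unfolding holomorphic2_on_def
  proof (intro conjI ballI)
    show "open (prod.swap -` S)"
      using F by (intro open_vimage) (auto simp: holomorphic2_on_def intro!: continuous_intros)
    fix q :: "complex \<times> complex" assume "q \<in> prod.swap -` S"
    then obtain a b where "(F has_derivative (\<lambda>(h, k). a * h + b * k)) (at (prod.swap q))"
      using F by (auto simp: holomorphic2_on_def)
    from has_derivative_compose[OF swap this]
    have "((F \<circ> prod.swap) has_derivative (\<lambda>(h, k). b * h + a * k)) (at q)"
      by (simp add: o_def prod.swap_def case_prod_unfold add.commute)
    then show "\<exists>a b. ((F \<circ> prod.swap) has_derivative (\<lambda>(h, k). a * h + b * k)) (at q)" by blast
  qed
  from partial_x_analytic_along[OF this, of C A] assms
  show ?thesis by (simp add: partial_x_def partial_y_def)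
qed


section \<open>Newton-Puiseux factorisations along an arc\<close>

lemma eval_to_fps_at_0 [simp]: "eval_fps (to_fps n c) 0 = c 0"
  by (simp add: eval_fps_at_0 to_fps_def)

lemma arc_curve_analytic:
  assumes "puiseux_arc c" and "ramified n c"
  shows "eval_fps (to_fps n c) analytic_on {0}" and "(\<lambda>t::complex. t ^ n) analytic_on {0}"
    and "n > 0"
  using has_fps_expansion_imp_analytic_0[OF arc_has_fps_expansion[OF assms]] assms(2)
  by (auto simp: ramified_def intro!: analytic_intros)

lemma germ_along_arc_analytic:
  assumes "holomorphic2_on F S" "puiseux_arc c" "ramified n c" "(c 0, 0) \<in> S"
  shows "(\<lambda>t. F (eval_fps (to_fps n c) t, t ^ n)) analytic_on {0}"
proof -
  note G = arc_curve_analytic[OF assms(2,3)]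
  show ?thesis by (rule holomorphic2_on_analytic_along[OF assms(1) _ G(1,2)]) (use assms(4) G(3) in \<open>simp add: zero_power\<close>)
qed

text \<open>
  The least admissible denominator in the definition of \<open>along\<close> may be replaced by any of its
  multiples. So one denominator can serve the arc, \<open>f\<close> and \<open>g\<close> at the same time.
\<close>
lemma along_eq_of_fps:
  assumes F: "(\<lambda>t. F (eval_fps (to_fps (ramification c) c) t, t ^ ramification c)) analytic_on {0}"
    and c: "puiseux_arc c" and m: "m > 0" and n: "n = ramification c * m"
  shows "along F c = of_fps n (fps_expansion (\<lambda>t. F (eval_fps (to_fps n c) t, t ^ n)) 0)"
proof -
  define N where "N = ramification c"
  define H where "H t = F (eval_fps (to_fps N c) t, t ^ N)" for t
  have N: "ramified N c" using c by (auto simp: N_def puiseux_arc_def intro: ramified_ramification)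
  have "H has_fps_expansion fps_expansion H 0"
    by (rule analytic_at_imp_has_fps_expansion_0) (use F in \<open>simp add: H_def[abs_def] N_def[symmetric]\<close>)
  then have "(H \<circ> (\<lambda>t. t ^ m)) has_fps_expansion (fps_expansion H 0 oo fps_X ^ m)"
    by (rule has_fps_expansion_compose) (use m in \<open>auto intro: fps_expansion_intros\<close>)
  moreover have "H \<circ> (\<lambda>t. t ^ m) = (\<lambda>t. F (eval_fps (to_fps n c) t, t ^ n))"
    by (simp add: fun_eq_iff H_def n N_def[symmetric] eval_to_fps_mult[OF N m] power_mult mult.commute
             flip: power_mult)
  ultimately have "fps_expansion (\<lambda>t. F (eval_fps (to_fps n c) t, t ^ n)) 0 = fps_expansion H 0 oo fps_X ^ m"
    by (simp add: fps_expansion_eqI)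
  then show ?thesis
    using of_fps_compose_power[OF m, of N] N
    by (simp add: along_def Let_def n N_def[symmetric] H_def[abs_def] ramified_def)
qed

lemma along_eq_0_iff:
  assumes F: "(\<lambda>t. F (eval_fps (to_fps (ramification c) c) t, t ^ ramification c)) analytic_on {0}"
    and F': "(\<lambda>t. F (eval_fps (to_fps n c) t, t ^ n)) analytic_on {0}"
    and c: "puiseux_arc c" and m: "m > 0" and n: "n = ramification c * m"
  shows "along F c = (\<lambda>_. 0) \<longleftrightarrow> (\<forall>\<^sub>F t in nhds 0. F (eval_fps (to_fps n c) t, t ^ n) = 0)"
proof -
  let ?H = "\<lambda>t. F (eval_fps (to_fps n c) t, t ^ n)"
  have "ramified (ramification c) c"
    using c by (auto simp: puiseux_arc_def intro: ramified_ramification)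
  then have "n > 0" using m n by (simp add: ramified_def)
  then have "along F c = (\<lambda>_. 0) \<longleftrightarrow> fps_expansion ?H 0 = 0"
    using along_eq_of_fps[OF F c m n] by (simp add: of_fps_eq_0_iff)
  also have "\<dots> \<longleftrightarrow> ?H has_fps_expansion 0"
    using analytic_at_imp_has_fps_expansion_0[OF F'] fps_expansion_eqI[of ?H 0] by auto
  finally show ?thesis by (simp add: has_fps_expansion_0_iff)
qed

lemma fps_expansion_tendsto_leading:
  fixes w :: "complex \<Rightarrow> complex"
  assumes "w has_fps_expansion A" and "k \<le> subdegree A"
  shows "((\<lambda>t. w t / t ^ k) \<longlongrightarrow> fps_nth A k) (at 0)"
proof -
  have "((\<lambda>t. if t = 0 then fps_nth A k else w t / t ^ k) \<longlongrightarrow> fps_nth (fps_shift k A) 0) (nhds 0)"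
    by (rule has_fps_expansion_imp_tendsto_0[OF has_fps_expansion_shift[OF assms refl]])
  then have "((\<lambda>t. if t = 0 then fps_nth A k else w t / t ^ k) \<longlongrightarrow> fps_nth A k) (at 0)"
    by (simp add: tendsto_nhds_iff)
  then show ?thesis
    by (rule Lim_transform_eventually) (auto simp: eventually_at_filter)
qed

lemma fps_expansion_nonzero_near:
  fixes w :: "complex \<Rightarrow> complex"
  assumes "w has_fps_expansion A" and "A \<noteq> 0"
  shows "\<forall>\<^sub>F t in at 0. w t \<noteq> 0"
proof -
  have "((\<lambda>t. w t / t ^ subdegree A) \<longlongrightarrow> fps_nth A (subdegree A)) (at 0)"
    by (rule fps_expansion_tendsto_leading[OF assms(1)]) simp
  then have "\<forall>\<^sub>F t in at 0. w t / t ^ subdegree A \<noteq> 0"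
    by (rule tendsto_imp_eventually_ne) (use assms(2) in simp)
  then show ?thesis by eventually_elim auto
qed

text \<open>
  If \<open>w = a t\<^sup>k + \<dots>\<close>, then \<open>t w' = k a t\<^sup>k + \<dots>\<close>.
\<close>
lemma log_derivative_tendsto:
  fixes w :: "complex \<Rightarrow> complex"
  assumes w: "w has_fps_expansion A" and "A \<noteq> 0"
  shows "((\<lambda>t. t * deriv w t / w t) \<longlongrightarrow> of_nat (subdegree A)) (at 0)"
proof -
  let ?k = "subdegree A"
  have X: "(\<lambda>t. t * deriv w t) has_fps_expansion fps_X * fps_deriv A"
    using w by (intro fps_expansion_intros)
  have nth: "fps_nth (fps_X * fps_deriv A) j = of_nat j * fps_nth A j" for j
    by (cases j) auto
  have le: "?k \<le> subdegree (fps_X * fps_deriv A)"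
  proof (cases "?k = 0")
    case False
    show ?thesis
    proof (rule subdegree_geI)
      have "fps_nth (fps_X * fps_deriv A) ?k \<noteq> 0" unfolding nth using False assms(2) by simp
      then show "fps_X * fps_deriv A \<noteq> 0" by (rule fps_nonzeroI)
      show "fps_nth (fps_X * fps_deriv A) i = 0" if "i < ?k" for i
        unfolding nth using that by (simp only: nth_less_subdegree_zero mult_zero_right)
    qed
  qed simp
  have "((\<lambda>t. t * deriv w t / t ^ ?k) \<longlongrightarrow> fps_nth (fps_X * fps_deriv A) ?k) (at 0)"
    by (rule fps_expansion_tendsto_leading[OF X le])
  then have "((\<lambda>t. (t * deriv w t / t ^ ?k) / (w t / t ^ ?k)) \<longlongrightarrow>
      of_nat ?k * fps_nth A ?k / fps_nth A ?k) (at 0)"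
    unfolding nth using assms(2)
    by (intro tendsto_divide fps_expansion_tendsto_leading[OF w]) auto
  then have "((\<lambda>t. (t * deriv w t / t ^ ?k) / (w t / t ^ ?k)) \<longlongrightarrow> of_nat ?k) (at 0)"
    using assms(2) by simp
  then show ?thesis by (rule Lim_transform_eventually) (auto simp: eventually_at_filter)
qed

lemma reciprocal_tendsto:
  fixes w :: "complex \<Rightarrow> complex"
  assumes w: "w has_fps_expansion A" and "A \<noteq> 0" and "subdegree A \<le> k"
  shows "((\<lambda>t. t ^ k / w t) \<longlongrightarrow> (if subdegree A = k then 1 / fps_nth A k else 0)) (at 0)"
proof -
  let ?j = "subdegree A"
  have "((\<lambda>t. t ^ (k - ?j) / (w t / t ^ ?j)) \<longlongrightarrow> 0 ^ (k - ?j) / fps_nth A ?j) (at 0)"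
    using assms(2) by (intro tendsto_intros fps_expansion_tendsto_leading[OF w]) auto
  then have "((\<lambda>t. t ^ (k - ?j) / (w t / t ^ ?j)) \<longlongrightarrow>
      (if ?j = k then 1 / fps_nth A k else 0)) (at 0)"
    using assms(3) by (auto simp: power_0_left split: if_splits)
  then show ?thesis
  proof (rule Lim_transform_eventually)
    show "\<forall>\<^sub>F t in at 0. t ^ (k - ?j) / (w t / t ^ ?j) = t ^ k / w t"
      using assms(3) by (auto simp: eventually_at_filter power_add[symmetric])
  qed
qed

text \<open>
  A Newton-Puiseux factorisation with its neighbourhoods made explicit: \<open>S\<close> lies in the
  \<open>(x, y)\<close>-plane and \<open>W\<close> in the \<open>(x, t)\<close>-plane, where \<open>y = t\<^sup>n\<close>. Open sets instead of germs allow the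
  factorisation to be used at points \<open>(x, 0)\<close> with \<open>x \<noteq> 0\<close>, as the ground bar requires, and to be
  differentiated in \<open>x\<close> at the points of an arc.
\<close>
locale newton_puiseux_chart =
  fixes F u :: "complex \<times> complex \<Rightarrow> complex" and E :: nat and R :: "frac_series set"
    and S :: "(complex \<times> complex) set" and n :: nat and W :: "(complex \<times> complex) set"
  assumes hol_F: "holomorphic2_on F S" and hol_u: "holomorphic2_on u S"
    and unit: "p \<in> S \<Longrightarrow> u p \<noteq> 0"
    and finite_roots: "finite R" and root_arc: "\<alpha> \<in> R \<Longrightarrow> puiseux_arc \<alpha>"
    and n_pos: "n > 0" and root_ramified: "\<alpha> \<in> R \<Longrightarrow> ramified n \<alpha>"
    and open_W: "open W"
    and factorisation: "(x, t) \<in> W \<Longrightarrow>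
      F (x, t ^ n) = u (x, t ^ n) * (t ^ n) ^ E * (\<Prod>\<alpha>\<in>R. x - eval_fps (to_fps n \<alpha>) t)"
    and origin: "(0, 0) \<in> S" "(0, 0) \<in> W"

lemma newton_puiseux_chart_exists:
  assumes "newton_puiseux F u E R" and "holomorphic_germ F"
  shows "\<exists>S n W. newton_puiseux_chart F u E R S n W"
proof -
  obtain S1 where S1: "holomorphic2_on F S1" "(0, 0) \<in> S1"
    using assms(2) by (auto simp: holomorphic_germ_iff)
  have u: "holomorphic_germ u" "u (0, 0) \<noteq> 0" and R: "finite R" "\<forall>\<alpha>\<in>R. puiseux_arc \<alpha>"
    using assms(1) by (auto simp: newton_puiseux_def unit_germ_def)
  obtain S2 where S2: "holomorphic2_on u S2" "(0, 0) \<in> S2"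
    using u by (auto simp: holomorphic_germ_iff)
  obtain n where n: "n > 0" "\<forall>\<alpha>\<in>R. ramified n \<alpha>"
    and ev: "\<forall>\<^sub>F (x, t) in nhds (0, 0). F (x, t ^ n) =
      u (x, t ^ n) * (t ^ n) ^ E * (\<Prod>\<alpha>\<in>R. x - eval_fps (to_fps n \<alpha>) t)"
    using assms(1) by (auto simp: newton_puiseux_def)
  obtain W where W: "open W" "(0, 0) \<in> W" "\<And>x t. (x, t) \<in> W \<Longrightarrow> F (x, t ^ n) =
      u (x, t ^ n) * (t ^ n) ^ E * (\<Prod>\<alpha>\<in>R. x - eval_fps (to_fps n \<alpha>) t)"
    using ev unfolding eventually_nhds by (elim exE) (rule that, auto)
  define S where "S = S1 \<inter> (S2 \<inter> u -` (- {0}))"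
  have "open (S2 \<inter> u -` (- {0}))"
    using holomorphic2_on_imp_continuous_on[OF S2(1)] S2(1)
    by (auto simp: holomorphic2_on_def continuous_on_open_vimage Int_commute)
  then have "open S" using S1 by (auto simp: S_def holomorphic2_on_def)
  then have "newton_puiseux_chart F u E R S n W"
    using S1 S2 u R n W
    by unfold_locales (auto simp: S_def intro: holomorphic2_on_subset)
  then show ?thesis by blast
qed

lemma newton_puiseux_common_ramification:
  assumes "newton_puiseux f u E P" and "newton_puiseux g u' E' Q"
  shows "\<exists>n. \<forall>\<alpha>\<in>P \<union> Q. ramified n \<alpha>"
proof -
  obtain n m where n: "n > 0" "\<forall>\<alpha>\<in>P. ramified n \<alpha>" and m: "m > 0" "\<forall>\<alpha>\<in>Q. ramified m \<alpha>"
    using assms by (auto simp: newton_puiseux_def)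
  have "ramified (n * m) \<alpha>" if "\<alpha> \<in> P \<union> Q" for \<alpha>
    using that n m ramified_mult[of n \<alpha> m] ramified_mult[of m \<alpha> n] by (auto simp: mult.commute)
  then show ?thesis by blast
qed

context newton_puiseux_chart begin

lemma scale:
  assumes m: "m > 0"
  shows "newton_puiseux_chart F u E R S (n * m) ((\<lambda>(x, t). (x, t ^ m)) -` W)"
proof unfold_locales
  show "open ((\<lambda>(x, t). (x, t ^ m)) -` W)"
    by (intro open_vimage open_W) (auto simp: case_prod_unfold intro!: continuous_intros)
  fix x t assume "(x, t) \<in> (\<lambda>(x, t). (x, t ^ m)) -` W"
  then have "(x, t ^ m) \<in> W" by simp
  from factorisation[OF this]
  have "F (x, t ^ (n * m)) = u (x, t ^ (n * m)) * (t ^ (n * m)) ^ E *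
      (\<Prod>\<alpha>\<in>R. x - eval_fps (to_fps n \<alpha>) (t ^ m))"
    by (simp add: power_mult[symmetric] mult.commute)
  also have "(\<Prod>\<alpha>\<in>R. x - eval_fps (to_fps n \<alpha>) (t ^ m)) = (\<Prod>\<alpha>\<in>R. x - eval_fps (to_fps (n * m) \<alpha>) t)"
    by (rule prod.cong[OF refl]) (simp add: eval_to_fps_mult[OF root_ramified m])
  finally show "F (x, t ^ (n * m)) = u (x, t ^ (n * m)) * (t ^ (n * m)) ^ E *
      (\<Prod>\<alpha>\<in>R. x - eval_fps (to_fps (n * m) \<alpha>) t)" .
qed (use hol_F hol_u unit finite_roots root_arc n_pos root_ramified origin m
      in \<open>auto intro: ramified_mult simp: zero_power\<close>)

context
  fixes c :: frac_series
  assumes c: "puiseux_arc c" "ramified n c" "c \<notin> R" "(c 0, 0) \<in> S" "(c 0, 0) \<in> W"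
begin

lemma curve_in_W: "\<forall>\<^sub>F t in nhds 0. (eval_fps (to_fps n c) t, t) \<in> W"
proof -
  obtain d where "d > 0" "\<And>t. t \<in> ball 0 d \<Longrightarrow> (eval_fps (to_fps n c) t, t) \<in> W"
    using analytic_at_curve_near[OF arc_curve_analytic(1)[OF c(1,2)] _ open_W, of "\<lambda>t. t"] c(5)
      analytic_on_ident by auto
  then show ?thesis by (intro eventually_nhds_in_open[of "ball 0 d", THEN eventually_mono]) auto
qed

lemma root_difference:
  assumes "\<alpha> \<in> R"
  shows "(\<lambda>t. eval_fps (to_fps n c) t - eval_fps (to_fps n \<alpha>) t) has_fps_expansion
           to_fps n c - to_fps n \<alpha>" (is ?exp)
    and "to_fps n c - to_fps n \<alpha> \<noteq> 0" (is ?nz)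
    and "contact c \<alpha> = ereal (real (subdegree (to_fps n c - to_fps n \<alpha>)) / real n)" (is ?con)
proof -
  have ne: "c \<noteq> \<alpha>" using assms c by auto
  note r = c(2) root_ramified[OF assms]
  show ?exp
    by (intro fps_expansion_intros arc_has_fps_expansion c(1) r root_arc assms)
  show ?nz using to_fps_eq_0_iff[OF ramified_diff[OF r]] diff_fun_neq_0[OF ne]
    by (simp add: to_fps_diff)
  show ?con by (rule contact_eq_subdegree[OF r ne])
qed

text \<open>
  Along \<open>c\<close> the factorisation is a product of power series in \<open>t\<close>: the unit contributes order \<open>0\<close>,
  the power of \<open>y\<close> order \<open>n E\<close>, and the root \<open>\<alpha>\<close> order \<open>n\<close> times its contact with \<open>c\<close>.
\<close>
lemma expansion_along:
  obtains A where "(\<lambda>t. F (eval_fps (to_fps n c) t, t ^ n)) has_fps_expansion A" "A \<noteq> 0"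
    "real (subdegree A) = real n * (real E + (\<Sum>\<alpha>\<in>R. real_of_ereal (contact c \<alpha>)))"
proof -
  define G where "G = eval_fps (to_fps n c)"
  define U where "U = fps_expansion (\<lambda>t. u (G t, t ^ n)) 0"
  define D where "D \<alpha> = to_fps n c - to_fps n \<alpha>" for \<alpha>
  define A where "A = U * (fps_X ^ n) ^ E * (\<Prod>\<alpha>\<in>R. D \<alpha>)"
  have U: "(\<lambda>t. u (G t, t ^ n)) has_fps_expansion U"
    unfolding U_def G_def
    by (intro analytic_at_imp_has_fps_expansion_0 germ_along_arc_analytic[OF hol_u c(1,2,4)])
  have "fps_nth U 0 = u (c 0, 0)"
    using has_fps_expansion_imp_0_eq_fps_nth_0[OF U] n_pos by (simp add: G_def zero_power)
  then have U0: "fps_nth U 0 \<noteq> 0" using unit[OF c(4)] by simp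
  then have sU: "subdegree U = 0" "U \<noteq> 0" by auto
  have D: "(\<lambda>t. G t - eval_fps (to_fps n \<alpha>) t) has_fps_expansion D \<alpha>" "D \<alpha> \<noteq> 0"
    "real (subdegree (D \<alpha>)) = real n * real_of_ereal (contact c \<alpha>)" if "\<alpha> \<in> R" for \<alpha>
    using root_difference[OF that] n_pos by (auto simp: G_def D_def)
  have prodD: "(\<Prod>\<alpha>\<in>T. D \<alpha>) \<noteq> 0 \<and> subdegree (\<Prod>\<alpha>\<in>T. D \<alpha>) = (\<Sum>\<alpha>\<in>T. subdegree (D \<alpha>))"
    if "T \<subseteq> R" for T
    using finite_subset[OF that finite_roots] that
    by (induction T rule: finite_induct) (auto simp: D(2))
  show ?thesis
  proof (rule that)
    have "(\<lambda>t. u (G t, t ^ n) * (t ^ n) ^ E * (\<Prod>\<alpha>\<in>R. G t - eval_fps (to_fps n \<alpha>) t)) has_fps_expansion A"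
      unfolding A_def by (intro fps_expansion_intros U D(1))
    moreover have "\<forall>\<^sub>F t in nhds 0. F (eval_fps (to_fps n c) t, t ^ n) =
        u (G t, t ^ n) * (t ^ n) ^ E * (\<Prod>\<alpha>\<in>R. G t - eval_fps (to_fps n \<alpha>) t)"
      using curve_in_W by eventually_elim (simp add: G_def factorisation)
    ultimately show "(\<lambda>t. F (eval_fps (to_fps n c) t, t ^ n)) has_fps_expansion A"
      by (subst has_fps_expansion_cong[OF _ refl])
    show "A \<noteq> 0" using sU prodD by (simp add: A_def)
    have "subdegree A = n * E + (\<Sum>\<alpha>\<in>R. subdegree (D \<alpha>))"
      using sU prodD[of R] by (simp add: A_def flip: power_mult)
    then have "real (subdegree A) = real n * real E + (\<Sum>\<alpha>\<in>R. real (subdegree (D \<alpha>)))"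
      by simp
    also have "(\<Sum>\<alpha>\<in>R. real (subdegree (D \<alpha>))) = real n * (\<Sum>\<alpha>\<in>R. real_of_ereal (contact c \<alpha>))"
      unfolding sum_distrib_left by (rule sum.cong) (use D(3) in auto)
    finally show "real (subdegree A) = real n * (real E + (\<Sum>\<alpha>\<in>R. real_of_ereal (contact c \<alpha>)))"
      by (simp add: algebra_simps)
  qed
qed

text \<open>
  The logarithmic derivative of the factorisation with respect to \<open>x\<close>, in which the power of
  \<open>y\<close> is constant.
\<close>
lemma partial_x_log_derivative:
  "\<forall>\<^sub>F t in at 0. F (eval_fps (to_fps n c) t, t ^ n) \<noteq> 0 \<and>
     partial_x F (eval_fps (to_fps n c) t, t ^ n) = F (eval_fps (to_fps n c) t, t ^ n) *
       (partial_x u (eval_fps (to_fps n c) t, t ^ n) / u (eval_fps (to_fps n c) t, t ^ n) +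
        (\<Sum>\<alpha>\<in>R. 1 / (eval_fps (to_fps n c) t - eval_fps (to_fps n \<alpha>) t)))"
proof -
  define G where "G = eval_fps (to_fps n c)"
  define a where "a \<alpha> = eval_fps (to_fps n \<alpha>)" for \<alpha>
  obtain A where A: "(\<lambda>t. F (eval_fps (to_fps n c) t, t ^ n)) has_fps_expansion A" "A \<noteq> 0"
    using expansion_along by blast
  have "\<forall>\<^sub>F t in at 0. \<forall>\<alpha>\<in>R. G t - a \<alpha> t \<noteq> 0"
  proof (rule eventually_ball_finite[OF finite_roots], rule ballI)
    fix \<alpha> assume "\<alpha> \<in> R"
    from fps_expansion_nonzero_near[OF root_difference(1,2)[OF this]]
    show "\<forall>\<^sub>F t in at 0. G t - a \<alpha> t \<noteq> 0" by (simp add: G_def a_def)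
  qed
  moreover have "\<forall>\<^sub>F t in at 0. F (G t, t ^ n) \<noteq> 0"
    unfolding G_def by (rule fps_expansion_nonzero_near[OF A])
  moreover have "\<forall>\<^sub>F t in at 0. (G t, t) \<in> W"
    using curve_in_W by (auto simp: G_def eventually_nhds_conv_at)
  moreover have "\<forall>\<^sub>F t in at 0. (G t, t ^ n) \<in> S"
  proof -
    have "open S" "(G 0, 0 ^ n) \<in> S"
      using hol_F c n_pos by (auto simp: G_def holomorphic2_on_def zero_power)
    then obtain d where "d > 0" "\<And>t. t \<in> ball 0 d \<Longrightarrow> (G t, t ^ n) \<in> S"
      using analytic_at_curve_near[of G "\<lambda>t. t ^ n" S] arc_curve_analytic(1,2)[OF c(1,2)]
      unfolding G_def by blast
    then show ?thesis
      by (intro eventually_at_ball[of d, THEN eventually_mono]) auto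
  qed
  ultimately have "\<forall>\<^sub>F t in at 0. F (G t, t ^ n) \<noteq> 0 \<and> partial_x F (G t, t ^ n) =
      F (G t, t ^ n) * (partial_x u (G t, t ^ n) / u (G t, t ^ n) + (\<Sum>\<alpha>\<in>R. 1 / (G t - a \<alpha> t)))"
  proof eventually_elim
    case (elim t)
    have u_nz: "u (G t, t ^ n) \<noteq> 0" using unit elim by auto
    have du: "((\<lambda>x. u (x, t ^ n)) has_field_derivative partial_x u (G t, t ^ n)) (at (G t))"
      using holomorphic2_on_chain_rule[OF hol_u, where A = "\<lambda>x. x" and C = "\<lambda>_. t ^ n" and t = "G t"
        and A' = 1 and C' = 0] elim by simp
    have dP: "((\<lambda>x. \<Prod>\<alpha>\<in>R. x - a \<alpha> t) has_field_derivative
        (\<Prod>\<alpha>\<in>R. G t - a \<alpha> t) * (\<Sum>\<alpha>\<in>R. 1 / (G t - a \<alpha> t))) (at (G t))"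
      by (rule has_field_derivative_prod') (use elim in \<open>auto intro!: derivative_eq_intros\<close>)
    have "((\<lambda>x. u (x, t ^ n) * (t ^ n) ^ E * (\<Prod>\<alpha>\<in>R. x - a \<alpha> t)) has_field_derivative
        u (G t, t ^ n) * (t ^ n) ^ E * (\<Prod>\<alpha>\<in>R. G t - a \<alpha> t) *
         (partial_x u (G t, t ^ n) / u (G t, t ^ n) + (\<Sum>\<alpha>\<in>R. 1 / (G t - a \<alpha> t)))) (at (G t))"
      by (rule DERIV_cong[OF DERIV_mult[OF DERIV_cmult_right[OF du] dP]])
        (use u_nz in \<open>simp add: field_simps\<close>)
    moreover have "\<forall>\<^sub>F x in nhds (G t). u (x, t ^ n) * (t ^ n) ^ E * (\<Prod>\<alpha>\<in>R. x - a \<alpha> t) = F (x, t ^ n)"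
    proof -
      have "open ((\<lambda>x. (x, t)) -` W)" by (intro open_vimage open_W continuous_intros)
      then have "\<forall>\<^sub>F x in nhds (G t). x \<in> (\<lambda>x. (x, t)) -` W"
        using elim by (intro eventually_nhds_in_open) auto
      then show ?thesis by eventually_elim (simp add: factorisation a_def)
    qed
    ultimately have "((\<lambda>x. F (x, t ^ n)) has_field_derivative
        u (G t, t ^ n) * (t ^ n) ^ E * (\<Prod>\<alpha>\<in>R. G t - a \<alpha> t) *
         (partial_x u (G t, t ^ n) / u (G t, t ^ n) + (\<Sum>\<alpha>\<in>R. 1 / (G t - a \<alpha> t)))) (at (G t))"
      by (subst (asm) DERIV_cong_ev[OF refl _ refl])
    then have "partial_x F (G t, t ^ n) = u (G t, t ^ n) * (t ^ n) ^ E * (\<Prod>\<alpha>\<in>R. G t - a \<alpha> t) *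
         (partial_x u (G t, t ^ n) / u (G t, t ^ n) + (\<Sum>\<alpha>\<in>R. 1 / (G t - a \<alpha> t)))"
      by (simp add: partial_x_def DERIV_imp_deriv)
    also have "u (G t, t ^ n) * (t ^ n) ^ E * (\<Prod>\<alpha>\<in>R. G t - a \<alpha> t) = F (G t, t ^ n)"
      using elim by (simp add: factorisation a_def)
    finally show ?case using elim by simp
  qed
  then show ?thesis by (simp add: G_def a_def)
qed

text \<open>
  Among the terms \<open>1 / (c - \<alpha>)\<close> only those of maximal contact \<open>k\<close> survive the multiplication by
  \<open>t\<^sup>K = y\<^sup>k\<close>; the term that comes from the unit is bounded and disappears as well.
\<close>
lemma partial_x_log_derivative_tendsto:
  assumes K: "K > 0" "real K = real n * k"
    and le: "\<And>\<alpha>. \<alpha> \<in> R \<Longrightarrow> contact c \<alpha> \<le> ereal k"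
    and eq: "\<And>\<alpha>. \<alpha> \<in> R \<Longrightarrow> contact c \<alpha> = ereal k \<Longrightarrow> c k - \<alpha> k = b"
  shows "((\<lambda>t. t ^ K * partial_x F (eval_fps (to_fps n c) t, t ^ n) / F (eval_fps (to_fps n c) t, t ^ n))
     \<longlongrightarrow> of_nat (card {\<alpha>\<in>R. contact c \<alpha> = ereal k}) / b) (at 0)"
proof -
  define G where "G = eval_fps (to_fps n c)"
  define a where "a \<alpha> = eval_fps (to_fps n \<alpha>)" for \<alpha>
  have n0: "(0::complex) ^ n = 0" using n_pos by simp
  have cont: "((\<lambda>t. h (G t, t ^ n)) \<longlongrightarrow> h (G 0, 0 ^ n)) (at 0)"
    if "(\<lambda>t. h (G t, t ^ n)) analytic_on {0}" for h
    using analytic_at_imp_isCont[OF that] by (simp add: isCont_def)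
  have u: "((\<lambda>t. u (G t, t ^ n)) \<longlongrightarrow> u (G 0, 0 ^ n)) (at 0)"
    by (rule cont) (use germ_along_arc_analytic[OF hol_u c(1,2,4)] in \<open>simp add: G_def\<close>)
  have "(\<lambda>t. partial_x u (G t, t ^ n)) analytic_on {0}"
    using partial_x_analytic_along[OF hol_u _ arc_curve_analytic(1,2)[OF c(1,2)]] c(4)
    by (simp add: G_def n0)
  then have ux: "((\<lambda>t. partial_x u (G t, t ^ n)) \<longlongrightarrow> partial_x u (G 0, 0 ^ n)) (at 0)"
    by (rule cont)
  have u_nz: "u (G 0, 0 ^ n) \<noteq> 0" using unit[OF c(4)] by (simp add: G_def n0)
  have "((\<lambda>t. t ^ K * (partial_x u (G t, t ^ n) / u (G t, t ^ n))) \<longlongrightarrow>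
      0 ^ K * (partial_x u (G 0, 0 ^ n) / u (G 0, 0 ^ n))) (at 0)"
    by (intro tendsto_mult tendsto_power tendsto_ident_at tendsto_divide u ux u_nz)
  moreover have "((\<lambda>t. t ^ K / (G t - a \<alpha> t)) \<longlongrightarrow> (if contact c \<alpha> = ereal k then 1 / b else 0)) (at 0)"
    if "\<alpha> \<in> R" for \<alpha>
  proof -
    note rd = root_difference[OF that]
    let ?j = "subdegree (to_fps n c - to_fps n \<alpha>)"
    have k: "k = real K / real n" using K n_pos by (simp add: field_simps)
    have "real ?j / real n \<le> real K / real n" using le[OF that] rd(3) k by simp
    then have "?j \<le> K" using n_pos by (simp add: divide_le_cancel)
    moreover have "?j = K \<longleftrightarrow> contact c \<alpha> = ereal k" using rd(3) k n_pos by simp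
    moreover have "fps_nth (to_fps n c - to_fps n \<alpha>) K = b" if "contact c \<alpha> = ereal k"
      using eq[OF \<open>\<alpha> \<in> R\<close> that] k by (simp add: to_fps_def)
    ultimately show ?thesis
      using reciprocal_tendsto[OF rd(1,2), of K] by (auto simp: G_def a_def split: if_splits)
  qed
  ultimately have "((\<lambda>t. t ^ K * (partial_x u (G t, t ^ n) / u (G t, t ^ n)) +
      (\<Sum>\<alpha>\<in>R. t ^ K / (G t - a \<alpha> t))) \<longlongrightarrow>
      0 ^ K * (partial_x u (G 0, 0 ^ n) / u (G 0, 0 ^ n)) +
      (\<Sum>\<alpha>\<in>R. if contact c \<alpha> = ereal k then 1 / b else 0)) (at 0)"
    by (intro tendsto_add tendsto_sum)
  also have "0 ^ K * (partial_x u (G 0, 0 ^ n) / u (G 0, 0 ^ n)) +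
      (\<Sum>\<alpha>\<in>R. if contact c \<alpha> = ereal k then 1 / b else 0) =
      of_nat (card {\<alpha>\<in>R. contact c \<alpha> = ereal k}) / b"
    using finite_roots K(1) by (simp flip: sum.inter_filter)
  finally show ?thesis
  proof (rule Lim_transform_eventually)
    show "\<forall>\<^sub>F t in at 0. t ^ K * (partial_x u (G t, t ^ n) / u (G t, t ^ n)) +
        (\<Sum>\<alpha>\<in>R. t ^ K / (G t - a \<alpha> t)) =
        t ^ K * partial_x F (eval_fps (to_fps n c) t, t ^ n) / F (eval_fps (to_fps n c) t, t ^ n)"
      using partial_x_log_derivative
    proof eventually_elim
      case (elim t)
      then have nz: "F (eval_fps (to_fps n c) t, t ^ n) \<noteq> 0" by blast
      have cancel: "t ^ K * (F (eval_fps (to_fps n c) t, t ^ n) * L) /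
          F (eval_fps (to_fps n c) t, t ^ n) = t ^ K * L" for L
        using nz by simp
      show ?case
        unfolding elim[THEN conjunct2] cancel
        unfolding distrib_left sum_distrib_left G_def a_def by simp
    qed
  qed
qed

end

lemma ord_y_along:
  assumes c: "puiseux_arc c" "c \<notin> R" "(c 0, 0) \<in> S" "(c 0, 0) \<in> W"
  shows "ord_y (along F c) = ereal (real E + (\<Sum>\<alpha>\<in>R. real_of_ereal (contact c \<alpha>)))"
proof -
  define N where "N = ramification c"
  have N: "ramified N c" "N > 0"
    using c(1) ramified_ramification by (auto simp: N_def puiseux_arc_def ramified_def)
  interpret scaled: newton_puiseux_chart F u E R S "n * N" "(\<lambda>(x, t). (x, t ^ N)) -` W"
    by (rule scale[OF N(2)])
  have ram: "ramified (n * N) c" using ramified_mult[OF N(1) n_pos] by (simp add: mult.commute)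
  obtain A where A: "(\<lambda>t. F (eval_fps (to_fps (n * N) c) t, t ^ (n * N))) has_fps_expansion A" "A \<noteq> 0"
    "real (subdegree A) = real (n * N) * (real E + (\<Sum>\<alpha>\<in>R. real_of_ereal (contact c \<alpha>)))"
    using scaled.expansion_along[OF c(1) ram c(2,3)] c(4) N(2) by (auto simp: zero_power)
  have "along F c = of_fps (n * N) A"
    using along_eq_of_fps[OF germ_along_arc_analytic[OF hol_F c(1) N(1)[unfolded N_def] c(3)] c(1) n_pos]
      fps_expansion_eqI[OF A(1)] by (simp add: N_def mult.commute)
  then show ?thesis using ord_y_of_fps[of "n * N" A] A n_pos N by simp
qed

end


section \<open>Polar roots\<close>

lemma deriv_along_arc:
  assumes F: "holomorphic2_on F S" and c: "puiseux_arc c" "ramified n c" "(c 0, 0) \<in> S"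
  shows "\<forall>\<^sub>F t in at 0. deriv (\<lambda>t. F (eval_fps (to_fps n c) t, t ^ n)) t =
      partial_x F (eval_fps (to_fps n c) t, t ^ n) * deriv (eval_fps (to_fps n c)) t +
      partial_y F (eval_fps (to_fps n c) t, t ^ n) * (of_nat n * t ^ (n - 1))"
proof -
  define G where "G = eval_fps (to_fps n c)"
  have "n > 0" using c by (simp add: ramified_def)
  then have "open S" "(G 0, 0 ^ n) \<in> S"
    using F c by (auto simp: G_def holomorphic2_on_def zero_power)
  then obtain d where d: "d > 0" "G holomorphic_on ball 0 d" "\<And>t. t \<in> ball 0 d \<Longrightarrow> (G t, t ^ n) \<in> S"
    using analytic_at_curve_near[of G "\<lambda>t. t ^ n" S] arc_curve_analytic(1,2)[OF c(1,2)]
    unfolding G_def by blast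
  have "deriv (\<lambda>t. F (G t, t ^ n)) t = partial_x F (G t, t ^ n) * deriv G t +
      partial_y F (G t, t ^ n) * (of_nat n * t ^ (n - 1))" if t: "t \<in> ball 0 d" for t
  proof (rule DERIV_imp_deriv, rule holomorphic2_on_chain_rule[where A = G and C = "\<lambda>t. t ^ n", OF F d(3)[OF t]])
    show "(G has_field_derivative deriv G t) (at t)"
      by (rule holomorphic_derivI[OF d(2) _ t]) simp
    show "((\<lambda>t. t ^ n) has_field_derivative of_nat n * t ^ (n - 1)) (at t)"
      by (auto intro!: derivative_eq_intros)
  qed
  then show ?thesis
    unfolding G_def[symmetric] using d(1)
    by (intro eventually_at_ball[of d, THEN eventually_mono]) auto
qed

lemma jacobian_along_arc_analytic:
  assumes "holomorphic2_on f S" "holomorphic2_on g S'" and c: "puiseux_arc c" "ramified n c"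
    and "(c 0, 0) \<in> S" "(c 0, 0) \<in> S'"
  shows "(\<lambda>t. jacobian f g (eval_fps (to_fps n c) t, t ^ n)) analytic_on {0}"
proof -
  note A = arc_curve_analytic[OF c]
  have "(eval_fps (to_fps n c) 0, 0 ^ n) \<in> S" "(eval_fps (to_fps n c) 0, 0 ^ n) \<in> S'"
    using assms A(3) by (simp_all add: zero_power)
  note p = partial_x_analytic_along[OF assms(1) this(1) A(1,2)]
    partial_y_analytic_along[OF assms(1) this(1) A(1,2)]
    partial_x_analytic_along[OF assms(2) this(2) A(1,2)]
    partial_y_analytic_along[OF assms(2) this(2) A(1,2)]
  show ?thesis
    unfolding jacobian_def by (rule analytic_on_diff analytic_on_mult p)+
qed

text \<open>
  By the chain rule \<open>\<phi>' = f\<^sub>x \<gamma>' + f\<^sub>y n t\<^bsup>n - 1\<^esup>\<close> for the values \<open>\<phi>\<close> of \<open>f\<close> along \<open>\<gamma> = c\<close>, and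
  similarly for the values \<open>\<psi>\<close> of \<open>g\<close>; eliminating \<open>\<gamma>'\<close> turns \<open>J = 0\<close> into \<open>\<phi>' g\<^sub>x = \<psi>' f\<^sub>x\<close>. The
  claim compares the leading coefficients of both sides, divided by \<open>\<phi> \<psi>\<close>.
\<close>
lemma jacobian_vanishing_along_balance:
  assumes f: "newton_puiseux_chart f u E R S n W" and g: "newton_puiseux_chart g u' E' R' S' n W'"
    and c: "puiseux_arc c" "ramified n c" "c \<notin> R" "c \<notin> R'" "c 0 = 0"
    and K: "K > 0" "real K = real n * k" and b: "b \<noteq> 0"
    and le: "\<And>\<alpha>. \<alpha> \<in> R \<union> R' \<Longrightarrow> contact c \<alpha> \<le> ereal k"
    and eq: "\<And>\<alpha>. \<alpha> \<in> R \<union> R' \<Longrightarrow> contact c \<alpha> = ereal k \<Longrightarrow> c k - \<alpha> k = b"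
    and J: "\<forall>\<^sub>F t in nhds 0. jacobian f g (eval_fps (to_fps n c) t, t ^ n) = 0"
  shows "(real E + (\<Sum>\<alpha>\<in>R. real_of_ereal (contact c \<alpha>))) * real (card {\<beta>\<in>R'. contact c \<beta> = ereal k}) =
    (real E' + (\<Sum>\<beta>\<in>R'. real_of_ereal (contact c \<beta>))) * real (card {\<alpha>\<in>R. contact c \<alpha> = ereal k})"
proof -
  interpret f: newton_puiseux_chart f u E R S n W by (rule f)
  interpret g: newton_puiseux_chart g u' E' R' S' n W' by (rule g)
  define G where "G = eval_fps (to_fps n c)"
  define \<phi> where "\<phi> t = f (G t, t ^ n)" for t
  define \<psi> where "\<psi> t = g (G t, t ^ n)" for t
  define fx where "fx t = partial_x f (G t, t ^ n)" for t
  define gx where "gx t = partial_x g (G t, t ^ n)" for t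
  have c0: "(c 0, 0) \<in> S" "(c 0, 0) \<in> W" "(c 0, 0) \<in> S'" "(c 0, 0) \<in> W'"
    using c(5) f.origin g.origin by auto
  obtain A where A: "\<phi> has_fps_expansion A" "A \<noteq> 0"
    "real (subdegree A) = real n * (real E + (\<Sum>\<alpha>\<in>R. real_of_ereal (contact c \<alpha>)))"
    using f.expansion_along[OF c(1-3) c0(1,2)] unfolding \<phi>_def G_def by blast
  obtain A' where A': "\<psi> has_fps_expansion A'" "A' \<noteq> 0"
    "real (subdegree A') = real n * (real E' + (\<Sum>\<beta>\<in>R'. real_of_ereal (contact c \<beta>)))"
    using g.expansion_along[OF c(1,2,4) c0(3,4)] unfolding \<psi>_def G_def by blast
  let ?s = "card {\<alpha>\<in>R. contact c \<alpha> = ereal k}" and ?t = "card {\<beta>\<in>R'. contact c \<beta> = ereal k}"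
  have lim_f: "((\<lambda>t. t ^ K * fx t / \<phi> t) \<longlongrightarrow> of_nat ?s / b) (at 0)"
    unfolding fx_def \<phi>_def G_def
    by (rule f.partial_x_log_derivative_tendsto[OF c(1-3) c0(1,2) K]) (use le eq in auto)
  have lim_g: "((\<lambda>t. t ^ K * gx t / \<psi> t) \<longlongrightarrow> of_nat ?t / b) (at 0)"
    unfolding gx_def \<psi>_def G_def
    by (rule g.partial_x_log_derivative_tendsto[OF c(1,2,4) c0(3,4) K]) (use le eq in auto)
  have "((\<lambda>t. (t * deriv \<phi> t / \<phi> t) * (t ^ K * gx t / \<psi> t) - (t * deriv \<psi> t / \<psi> t) * (t ^ K * fx t / \<phi> t))
      \<longlongrightarrow> of_nat (subdegree A) * (of_nat ?t / b) - of_nat (subdegree A') * (of_nat ?s / b)) (at 0)"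
    by (intro tendsto_diff tendsto_mult lim_f lim_g log_derivative_tendsto A A')
  moreover have "\<forall>\<^sub>F t in at 0. (t * deriv \<phi> t / \<phi> t) * (t ^ K * gx t / \<psi> t) -
      (t * deriv \<psi> t / \<psi> t) * (t ^ K * fx t / \<phi> t) = 0"
  proof -
    have "\<forall>\<^sub>F t in at 0. jacobian f g (G t, t ^ n) = 0"
      using J by (auto simp: eventually_nhds_conv_at G_def)
    then show ?thesis
      using deriv_along_arc[OF f.hol_F c(1,2) c0(1)] deriv_along_arc[OF g.hol_F c(1,2) c0(3)]
    proof eventually_elim
      case (elim t)
      let ?m = "of_nat n * t ^ (n - 1)"
      have J: "partial_y f (G t, t ^ n) * gx t - fx t * partial_y g (G t, t ^ n) = 0"
        using elim(1) by (simp add: jacobian_def fx_def gx_def)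
      have "deriv \<phi> t = fx t * deriv G t + partial_y f (G t, t ^ n) * ?m"
        "deriv \<psi> t = gx t * deriv G t + partial_y g (G t, t ^ n) * ?m"
        using elim(2,3) by (simp_all add: \<phi>_def[abs_def] \<psi>_def[abs_def] G_def fx_def gx_def)
      then have "deriv \<phi> t * gx t - deriv \<psi> t * fx t =
          ?m * (partial_y f (G t, t ^ n) * gx t - fx t * partial_y g (G t, t ^ n))"
        by (simp add: algebra_simps)
      then have eq: "deriv \<phi> t * gx t = deriv \<psi> t * fx t" unfolding J by simp
      have "(t * deriv \<phi> t / \<phi> t) * (t ^ K * gx t / \<psi> t) - (t * deriv \<psi> t / \<psi> t) * (t ^ K * fx t / \<phi> t)
          = t * t ^ K * (deriv \<phi> t * gx t - deriv \<psi> t * fx t) / (\<phi> t * \<psi> t)"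
        by (simp add: algebra_simps diff_divide_distrib)
      then show ?case using eq by simp
    qed
  qed
  then have "((\<lambda>t. (t * deriv \<phi> t / \<phi> t) * (t ^ K * gx t / \<psi> t) -
      (t * deriv \<psi> t / \<psi> t) * (t ^ K * fx t / \<phi> t)) \<longlongrightarrow> 0) (at 0)"
    by (rule tendsto_eventually)
  ultimately have "of_nat (subdegree A) * (of_nat ?t / b) - of_nat (subdegree A') * (of_nat ?s / b) = 0"
    by (rule tendsto_unique[OF trivial_limit_at])
  then have "(of_nat (subdegree A * ?t) :: complex) = of_nat (subdegree A' * ?s)"
    using b by (simp add: field_simps)
  then have "real (subdegree A) * real ?t = real (subdegree A') * real ?s"
    by (simp only: of_nat_eq_iff flip: of_nat_mult)
  then show ?thesis
    unfolding A(3) A'(3) using f.n_pos by simp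
qed

text \<open>
  If no root has contact \<open>k\<close>, both sides are \<open>0\<close>. Otherwise \<open>k\<close> is an exponent of a difference
  of two series, so that \<open>y\<^sup>k\<close> is an integral power of the parameter.
\<close>
lemma polar_root_balance:
  assumes f: "newton_puiseux f u E R" "holomorphic_germ f"
    and g: "newton_puiseux g u' E' R'" "holomorphic_germ g"
    and polar: "polar_root f g \<gamma>" and k: "k > 0" and b: "b \<noteq> 0"
    and le: "\<And>\<alpha>. \<alpha> \<in> R \<union> R' \<Longrightarrow> contact \<gamma> \<alpha> \<le> ereal k"
    and eq: "\<And>\<alpha>. \<alpha> \<in> R \<union> R' \<Longrightarrow> contact \<gamma> \<alpha> = ereal k \<Longrightarrow> \<gamma> k - \<alpha> k = b"
  shows "(real E + (\<Sum>\<alpha>\<in>R. real_of_ereal (contact \<gamma> \<alpha>))) * real (card {\<beta>\<in>R'. contact \<gamma> \<beta> = ereal k}) =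
    (real E' + (\<Sum>\<beta>\<in>R'. real_of_ereal (contact \<gamma> \<beta>))) * real (card {\<alpha>\<in>R. contact \<gamma> \<alpha> = ereal k})"
proof (cases "\<exists>\<alpha>\<in>R \<union> R'. contact \<gamma> \<alpha> = ereal k")
  case False
  then have "{\<beta>\<in>R'. contact \<gamma> \<beta> = ereal k} = {}" "{\<alpha>\<in>R. contact \<gamma> \<alpha> = ereal k} = {}" by auto
  then show ?thesis by (simp only: card.empty)
next
  case True
  then obtain \<alpha> where \<alpha>: "\<alpha> \<in> R \<union> R'" "contact \<gamma> \<alpha> = ereal k" by blast
  have \<gamma>: "puiseux_arc \<gamma>" "\<gamma> 0 = 0" "along (jacobian f g) \<gamma> = (\<lambda>_. 0)"
    using polar ord_y_pos_imp[of \<gamma> 0] by (auto simp: polar_root_def)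
  have "\<gamma> \<notin> R \<union> R'" using le[of \<gamma>] by auto
  define N where "N = ramification \<gamma>"
  have N: "ramified N \<gamma>" "N > 0"
    using \<gamma>(1) ramified_ramification by (auto simp: N_def puiseux_arc_def ramified_def)
  obtain S1 n1 W1 where 1: "newton_puiseux_chart f u E R S1 n1 W1"
    using newton_puiseux_chart_exists[OF f] by blast
  obtain S2 n2 W2 where 2: "newton_puiseux_chart g u' E' R' S2 n2 W2"
    using newton_puiseux_chart_exists[OF g] by blast
  interpret f: newton_puiseux_chart f u E R S1 n1 W1 by (rule 1)
  interpret g: newton_puiseux_chart g u' E' R' S2 n2 W2 by (rule 2)
  \<comment> \<open>The denominator must be a multiple of the least one of \<open>\<gamma>\<close>, so that \<open>along\<close> can be
    computed with it.\<close>
  define n where "n = N * (n1 * n2)"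
  have n: "n > 0" using N f.n_pos g.n_pos by (simp add: n_def)
  have charts: "\<exists>W. newton_puiseux_chart f u E R S1 n W" "\<exists>W. newton_puiseux_chart g u' E' R' S2 n W"
    using f.scale[of "n2 * N"] g.scale[of "n1 * N"] N f.n_pos g.n_pos
    by (auto simp: n_def mult.assoc mult.commute mult.left_commute)
  then obtain W W' where charts: "newton_puiseux_chart f u E R S1 n W"
    "newton_puiseux_chart g u' E' R' S2 n W'" by blast
  have ram: "ramified n \<gamma>" unfolding n_def using N f.n_pos g.n_pos by (intro ramified_mult) auto
  have "ramified n \<alpha>"
    using \<alpha>(1) newton_puiseux_chart.root_ramified charts by blast
  moreover have "\<gamma> \<noteq> \<alpha>" using \<alpha> by auto
  ultimately have "k = real (subdegree (to_fps n \<gamma> - to_fps n \<alpha>)) / real n"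
    using contact_eq_subdegree[OF ram] \<alpha>(2) by simp
  then obtain K :: nat where K: "k = real K / real n" by blast
  then have "K > 0" "real K = real n * k" using k n by (auto intro: gr0I)
  have origin: "(\<gamma> 0, 0) \<in> S1" "(\<gamma> 0, 0) \<in> S2" using \<gamma>(2) f.origin g.origin by auto
  have "\<forall>\<^sub>F t in nhds 0. jacobian f g (eval_fps (to_fps n \<gamma>) t, t ^ n) = 0"
    using along_eq_0_iff[OF jacobian_along_arc_analytic[OF f.hol_F g.hol_F \<gamma>(1) N(1)[unfolded N_def] origin]
        jacobian_along_arc_analytic[OF f.hol_F g.hol_F \<gamma>(1) ram origin] \<gamma>(1), of "n1 * n2"]
      \<gamma>(3) f.n_pos g.n_pos by (simp add: n_def N_def)
  then show ?thesis
    using \<open>\<gamma> \<notin> R \<union> R'\<close> le eq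
    by (intro jacobian_vanishing_along_balance[OF charts \<gamma>(1) ram _ _ \<gamma>(2) \<open>K > 0\<close> \<open>real K = real n * k\<close> b]) auto
qed


section \<open>The tree of roots\<close>

locale root_tree =
  fixes \<Lambda> :: "frac_series set" and n :: nat
  assumes finite_\<Lambda>: "finite \<Lambda>" and nonempty_\<Lambda>: "\<Lambda> \<noteq> {}"
    and ram: "\<alpha> \<in> \<Lambda> \<Longrightarrow> ramified n \<alpha>" and order_pos: "\<alpha> \<in> \<Lambda> \<Longrightarrow> ord_y \<alpha> > 0"
begin

lemma n_pos: "n > 0"
  using nonempty_\<Lambda> ram by (auto simp: ramified_def)

lemma root_0: "\<alpha> \<in> \<Lambda> \<Longrightarrow> e \<le> 0 \<Longrightarrow> \<alpha> e = 0"
  by (rule ord_y_pos_imp[OF order_pos])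

text \<open>
  The invariant of the recursive construction of the tree: the members of a bar of height \<open>h\<close>
  are all the roots whose contact with a given member is at least \<open>h\<close>. That heights are
  multiples of \<open>1 / n\<close> makes generic arcs over a bar ramified.
\<close>
definition proper_bar :: "bar \<Rightarrow> bool" where
  "proper_bar B \<longleftrightarrow> members B \<subseteq> \<Lambda> \<and> members B \<noteq> {} \<and> (\<exists>k::nat. height B = real k / real n) \<and>
     (\<forall>\<xi>\<in>members B. \<forall>\<alpha>\<in>\<Lambda>. ereal (height B) \<le> contact \<xi> \<alpha> \<longleftrightarrow> \<alpha> \<in> members B)"

lemma proper_barD:
  assumes "proper_bar B"
  shows "members B \<subseteq> \<Lambda>" "members B \<noteq> {}" "height B \<ge> 0" "finite (members B)"
    and "\<xi> \<in> members B \<Longrightarrow> \<mu> \<in> members B \<Longrightarrow> ereal (height B) \<le> contact \<xi> \<mu>"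
    and "\<xi> \<in> members B \<Longrightarrow> \<alpha> \<in> \<Lambda> \<Longrightarrow> \<alpha> \<notin> members B \<Longrightarrow> contact \<xi> \<alpha> < ereal (height B)"
proof -
  show sub: "members B \<subseteq> \<Lambda>" and "members B \<noteq> {}"
    using assms by (simp_all add: proper_bar_def)
  show "finite (members B)" by (rule finite_subset[OF sub finite_\<Lambda>])
  show "height B \<ge> 0" using assms by (auto simp: proper_bar_def)
  have *: "\<And>\<xi> \<alpha>. \<xi> \<in> members B \<Longrightarrow> \<alpha> \<in> \<Lambda> \<Longrightarrow> ereal (height B) \<le> contact \<xi> \<alpha> \<longleftrightarrow> \<alpha> \<in> members B"
    using assms by (simp add: proper_bar_def)
  show "\<xi> \<in> members B \<Longrightarrow> \<mu> \<in> members B \<Longrightarrow> ereal (height B) \<le> contact \<xi> \<mu>"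
    using *[of \<xi> \<mu>] sub by blast
  show "\<xi> \<in> members B \<Longrightarrow> \<alpha> \<in> \<Lambda> \<Longrightarrow> \<alpha> \<notin> members B \<Longrightarrow> contact \<xi> \<alpha> < ereal (height B)"
    using *[of \<xi> \<alpha>] by (simp add: not_le)
qed

lemma trunk_height_attained:
  assumes "finite T" and "trunk_height T = ereal h"
  shows "\<exists>\<xi>\<in>T. \<exists>\<mu>\<in>T. contact \<xi> \<mu> = ereal h"
    and "\<xi> \<in> T \<Longrightarrow> \<mu> \<in> T \<Longrightarrow> ereal h \<le> contact \<xi> \<mu>"
proof -
  define D where "D = {contact \<xi> \<mu> | \<xi> \<mu>. \<xi> \<in> T \<and> \<mu> \<in> T \<and> \<xi> \<noteq> \<mu>}"
  have inf: "Inf D = ereal h" using assms(2) by (simp add: trunk_height_def D_def)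
  have "D \<subseteq> (\<lambda>(\<xi>, \<mu>). contact \<xi> \<mu>) ` (T \<times> T)" by (auto simp: D_def)
  then have fin: "finite D" using assms(1) by (meson finite_SigmaI finite_imageI finite_subset)
  have "D \<noteq> {}" using inf by (auto simp: top_ereal_def)
  then have "Inf D \<in> D" using fin Min_Inf[OF fin] Min_in[OF fin] by simp
  then have "ereal h \<in> D" using inf by simp
  then show "\<exists>\<xi>\<in>T. \<exists>\<mu>\<in>T. contact \<xi> \<mu> = ereal h" unfolding D_def by force
  show "ereal h \<le> contact \<xi> \<mu>" if "\<xi> \<in> T" "\<mu> \<in> T"
  proof (cases "\<xi> = \<mu>")
    case False
    then have "contact \<xi> \<mu> \<in> D" using that by (auto simp: D_def)
    then show ?thesis using Inf_lower[of _ D] inf by metis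
  qed simp
qed

text \<open>
  Among the members of \<open>B\<close> this is the definition of a trunk, up to the choice of its
  representative; every other root has contact less than the height of \<open>B\<close> with all members.
\<close>
lemma trunk_separation:
  assumes B: "proper_bar B" and T: "T \<in> trunks B" and \<xi>: "\<xi> \<in> T" and \<alpha>: "\<alpha> \<in> \<Lambda>"
  shows "ereal (height B) < contact \<xi> \<alpha> \<longleftrightarrow> \<alpha> \<in> T"
proof -
  obtain \<xi>0 where \<xi>0: "\<xi>0 \<in> members B" and T_eq: "T = {\<mu> \<in> members B. ereal (height B) < contact \<xi>0 \<mu>}"
    using T by (auto simp: trunks_def)
  have c: "ereal (height B) < contact \<xi>0 \<xi>" "\<xi> \<in> members B" using \<xi> by (auto simp: T_eq)
  show ?thesis
  proof
    assume *: "ereal (height B) < contact \<xi> \<alpha>"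
    then have "\<alpha> \<in> members B" using proper_barD(6)[OF B c(2) \<alpha>] by force
    moreover have "ereal (height B) < contact \<xi>0 \<alpha>"
      using less_le_trans[OF _ contact_ultrametric[of \<xi>0 \<xi> \<alpha>]] c(1) * by simp
    ultimately show "\<alpha> \<in> T" by (simp add: T_eq)
  next
    assume "\<alpha> \<in> T"
    then have "ereal (height B) < contact \<xi>0 \<alpha>" by (simp add: T_eq)
    then show "ereal (height B) < contact \<xi> \<alpha>"
      using less_le_trans[OF _ contact_ultrametric[of \<xi> \<xi>0 \<alpha>]] c(1) by (simp add: contact_commute[of \<xi> \<xi>0])
  qed
qed

lemma trunk_subset: "T \<in> trunks B \<Longrightarrow> T \<subseteq> members B"
  by (auto simp: trunks_def)

lemma trunk_nonempty: "T \<in> trunks B \<Longrightarrow> T \<noteq> {}"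
  by (auto simp: trunks_def)

lemma bar_on_trunk:
  assumes B: "proper_bar B" and T: "T \<in> trunks B" and h: "trunk_height T = ereal h"
  shows "proper_bar (Bar T h)" and "height B < h"
proof -
  have sub: "T \<subseteq> \<Lambda>" using trunk_subset[OF T] proper_barD(1)[OF B] by blast
  then have fin: "finite T" using finite_\<Lambda> finite_subset by blast
  obtain \<xi> \<mu> where \<xi>\<mu>: "\<xi> \<in> T" "\<mu> \<in> T" "contact \<xi> \<mu> = ereal h"
    using trunk_height_attained(1)[OF fin h] by blast
  then show hh: "height B < h" using trunk_separation[OF B T \<xi>\<mu>(1), of \<mu>] sub by auto
  have "\<xi> \<noteq> \<mu>" using \<xi>\<mu>(3) by auto
  then have "\<exists>k::nat. h = real k / real n"
    using contact_eq_subdegree[OF ram ram, of \<xi> \<mu>] \<xi>\<mu> sub by auto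
  moreover have "ereal h \<le> contact \<xi> \<alpha> \<longleftrightarrow> \<alpha> \<in> T" if "\<xi> \<in> T" "\<alpha> \<in> \<Lambda>" for \<xi> \<alpha>
  proof
    assume "ereal h \<le> contact \<xi> \<alpha>"
    then have "ereal (height B) < contact \<xi> \<alpha>" using hh by (meson ereal_less_le less_ereal.simps(1) less_le_trans)
    then show "\<alpha> \<in> T" using trunk_separation[OF B T that] by simp
  next
    assume "\<alpha> \<in> T"
    then show "ereal h \<le> contact \<xi> \<alpha>" using trunk_height_attained(2)[OF fin h that(1)] by simp
  qed
  ultimately show "proper_bar (Bar T h)"
    using sub trunk_nonempty[OF T] by (auto simp: proper_bar_def)
qed

lemma is_bar_proper: "is_bar \<Lambda> B \<Longrightarrow> proper_bar B"
proof (induction rule: is_bar.induct)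
  case ground
  have "ereal 0 \<le> contact \<xi> \<alpha>" if "\<xi> \<in> \<Lambda>" "\<alpha> \<in> \<Lambda>" for \<xi> \<alpha>
    unfolding contact_ge_iff
  proof (intro allI impI)
    fix e :: real assume "e < 0"
    then show "\<xi> e = \<alpha> e" using root_0[OF that(1), of e] root_0[OF that(2), of e] by simp
  qed
  moreover have "\<exists>k::nat. 0 = real k / real n" by (rule exI[of _ 0]) simp
  ultimately show ?case
    using nonempty_\<Lambda> by (simp add: proper_bar_def)
next
  case (on_top B T h)
  then show ?case using bar_on_trunk by blast
qed

lemma stem_eq:
  assumes "proper_bar B" "\<xi> \<in> members B" "e < height B"
  shows "stem B e = \<xi> e"
proof -
  have "(SOME \<xi>. \<xi> \<in> members B) \<in> members B" using assms(2) by (rule someI[of "\<lambda>\<xi>. \<xi> \<in> members B"])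
  then have "ereal (height B) \<le> contact (SOME \<xi>. \<xi> \<in> members B) \<xi>"
    using proper_barD(5)[OF assms(1)] assms(2) by blast
  then show ?thesis using assms(3) by (simp add: stem_def contact_ge_iff)
qed

lemma member_climbs_iff:
  "proper_bar B \<Longrightarrow> \<xi> \<in> members B \<Longrightarrow> climbs_over_at \<xi> B a \<longleftrightarrow> \<xi> (height B) = a"
  using stem_eq by (auto simp: climbs_over_at_def)

text \<open>
  Members of a bar agree below its height, so their contact exceeds the height if and only if
  their coefficients at the height agree.
\<close>
lemma grows_at_iff:
  assumes B: "proper_bar B"
  shows "grows_at T B a \<longleftrightarrow> T = {\<alpha>\<in>members B. \<alpha> (height B) = a} \<and> T \<noteq> {}"
proof -
  have cls: "{\<mu>\<in>members B. ereal (height B) < contact \<xi> \<mu>} = {\<mu>\<in>members B. \<mu> (height B) = \<xi> (height B)}"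
    if "\<xi> \<in> members B" for \<xi>
  proof (intro Collect_cong conj_cong refl)
    fix \<mu> assume \<mu>: "\<mu> \<in> members B"
    have "\<forall>e<height B. \<xi> e = \<mu> e"
      using proper_barD(5)[OF B that \<mu>] by (simp add: contact_ge_iff)
    moreover have "\<xi> \<in> \<Lambda>" "\<mu> \<in> \<Lambda>" using proper_barD(1)[OF B] that \<mu> by auto
    ultimately show "ereal (height B) < contact \<xi> \<mu> \<longleftrightarrow> \<mu> (height B) = \<xi> (height B)"
      using contact_gt_iff[OF ram ram, of \<xi> \<mu> "height B"] by auto
  qed
  show ?thesis
  proof
    assume "grows_at T B a"
    then obtain \<xi> where \<xi>: "\<xi> \<in> members B" "T = {\<mu>\<in>members B. ereal (height B) < contact \<xi> \<mu>}"
      and cl: "\<forall>\<xi>\<in>T. climbs_over_at \<xi> B a"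
      by (auto simp: grows_at_def trunks_def)
    note \<xi> = \<xi>(1) \<xi>(2)[unfolded cls[OF \<xi>(1)]]
    then have "\<xi> \<in> T" by simp
    then have "\<xi> (height B) = a" using cl member_climbs_iff[OF B \<xi>(1)] by blast
    then show "T = {\<alpha>\<in>members B. \<alpha> (height B) = a} \<and> T \<noteq> {}" using \<xi> \<open>\<xi> \<in> T\<close> by auto
  next
    assume T: "T = {\<alpha>\<in>members B. \<alpha> (height B) = a} \<and> T \<noteq> {}"
    then obtain \<xi> where \<xi>: "\<xi> \<in> members B" "\<xi> (height B) = a" by auto
    then have "T \<in> trunks B" using cls[OF \<xi>(1)] T unfolding trunks_def by auto
    then show "grows_at T B a" using T member_climbs_iff[OF B] by (auto simp: grows_at_def)
  qed
qed

lemma growth_points_eq: "proper_bar B \<Longrightarrow> growth_points B = (\<lambda>\<alpha>. \<alpha> (height B)) ` members B"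
  unfolding growth_points_def by (simp add: grows_at_iff) blast

lemma trunk_at_eq:
  assumes "proper_bar B" "grows_at T B a"
  shows "trunk_at B a = T"
  unfolding trunk_at_def
proof (rule the_equality)
  show "grows_at T B a" by (rule assms(2))
  fix T' assume "grows_at T' B a"
  then show "T' = T" using assms(2) unfolding grows_at_iff[OF assms(1)] by simp
qed

lemma sum_card_trunks:
  assumes B: "proper_bar B"
  shows "(\<Sum>a\<in>growth_points B. card (trunk_at B a \<inter> R)) = card (members B \<inter> R)"
proof -
  have "(\<Sum>a\<in>growth_points B. card (trunk_at B a \<inter> R)) =
      (\<Sum>a\<in>(\<lambda>\<alpha>. \<alpha> (height B)) ` members B. card {\<alpha> \<in> members B \<inter> R. \<alpha> (height B) = a})"
    unfolding growth_points_eq[OF B]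
  proof (rule sum.cong[OF refl])
    fix a assume "a \<in> (\<lambda>\<alpha>. \<alpha> (height B)) ` members B"
    then have "grows_at {\<alpha>\<in>members B. \<alpha> (height B) = a} B a" unfolding grows_at_iff[OF B] by blast
    from trunk_at_eq[OF B this] have "trunk_at B a \<inter> R = {\<alpha> \<in> members B \<inter> R. \<alpha> (height B) = a}" by blast
    then show "card (trunk_at B a \<inter> R) = card {\<alpha> \<in> members B \<inter> R. \<alpha> (height B) = a}" by (rule arg_cong)
  qed
  also have "\<dots> = (\<Sum>a\<in>(\<lambda>\<alpha>. \<alpha> (height B)) ` members B. \<Sum>\<alpha> | \<alpha> \<in> members B \<inter> R \<and> \<alpha> (height B) = a. 1)"
    by simp
  also have "\<dots> = (\<Sum>\<alpha>\<in>members B \<inter> R. 1)"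
    by (rule sum.group) (use proper_barD(4)[OF B] in auto)
  finally show ?thesis by simp
qed

text \<open>
  Members of \<open>T\<close> have contact at least \<open>h\<close> with \<open>\<xi>\<close>, so their truncated contact follows \<open>x\<close>;
  all other roots have contact at most the height of \<open>B\<close> and do not notice \<open>x\<close>.
\<close>
lemma sum_truncated_contact_above_trunk:
  assumes B: "proper_bar B" and T: "T \<in> trunks B" and h: "trunk_height T = ereal h"
    and \<xi>: "\<xi> \<in> T" and x: "height B \<le> x" "x \<le> h" and R: "R \<subseteq> \<Lambda>"
  shows "(\<Sum>\<alpha>\<in>R. truncated_contact \<xi> x \<alpha>) = (\<Sum>\<alpha>\<in>R. truncated_contact \<xi> (height B) \<alpha>) + real (card (T \<inter> R)) * (x - height B)"
proof -
  have finR: "finite R" using R finite_\<Lambda> finite_subset by blast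
  have finT: "finite T"
    using trunk_subset[OF T] proper_barD(4)[OF B] finite_subset by blast
  have "truncated_contact \<xi> x \<alpha> - truncated_contact \<xi> (height B) \<alpha> = (if \<alpha> \<in> T then x - height B else 0)" if "\<alpha> \<in> R" for \<alpha>
  proof (cases "\<alpha> \<in> T")
    case True
    have "ereal h \<le> contact \<xi> \<alpha>" using trunk_height_attained(2)[OF finT h \<xi> True] .
    then have "ereal x \<le> contact \<xi> \<alpha>" "ereal (height B) \<le> contact \<xi> \<alpha>"
      using x by (auto elim!: order_trans[rotated])
    then show ?thesis using True by (simp add: truncated_contact_def min_absorb1)
  next
    case False
    then have "contact \<xi> \<alpha> \<le> ereal (height B)"
      using trunk_separation[OF B T \<xi>] R that by (auto simp: not_less[symmetric])
    moreover from this have "contact \<xi> \<alpha> \<le> ereal x" using x(1) by (auto elim!: order_trans)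
    ultimately show ?thesis using False by (simp add: truncated_contact_def min_absorb2)
  qed
  then have "(\<Sum>\<alpha>\<in>R. truncated_contact \<xi> x \<alpha> - truncated_contact \<xi> (height B) \<alpha>) = (\<Sum>\<alpha>\<in>R. if \<alpha> \<in> T then x - height B else 0)"
    by (intro sum.cong) auto
  also have "\<dots> = (\<Sum>\<alpha>\<in>T \<inter> R. x - height B)"
    using finR by (simp add: sum.inter_restrict[symmetric] Int_commute)
  finally show ?thesis by (simp add: sum_subtractf)
qed

text \<open>
  The stem has finitely many terms, whatever the roots are beyond the height of \<open>B\<close>; so the arc
  converges everywhere.
\<close>
lemma generic_arc:
  assumes B: "proper_bar B"
  shows "puiseux_arc (\<lambda>e. stem B e + (if e = height B then z else 0))" (is "puiseux_arc ?c")
proof -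
  obtain \<xi> where \<xi>: "\<xi> \<in> members B" using proper_barD(2)[OF B] by blast
  then have ram\<xi>: "ramified n \<xi>" using proper_barD(1)[OF B] ram by blast
  obtain k :: nat where k: "height B = real k / real n" using B by (auto simp: proper_bar_def)
  have "ramified n ?c"
    unfolding ramified_def
  proof (intro conjI allI impI n_pos)
    fix e assume e: "?c e \<noteq> 0"
    show "\<exists>k::nat. e = real k / real n"
    proof (cases "e = height B")
      case False
      then have "e < height B" "stem B e \<noteq> 0" using e by (auto simp: stem_def split: if_splits)
      then have "\<xi> e \<noteq> 0" using stem_eq[OF B \<xi>] by simp
      then show ?thesis using ram\<xi> by (simp add: ramified_def)
    qed (use k in blast)
  qed
  moreover have "fps_conv_radius (to_fps n ?c) = \<infinity>"
  proof -
    have "fps_nth (to_fps n ?c) j = 0" if "j > k" for j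
    proof -
      have "real j / real n > height B" using that n_pos k by (simp add: divide_strict_right_mono)
      then show ?thesis by (simp add: to_fps_def stem_def)
    qed
    then have "\<forall>\<^sub>F j in sequentially. fps_nth (to_fps n ?c) j = 0"
      using eventually_gt_at_top[of k] by (rule eventually_mono[rotated])
    then show ?thesis
      using conv_radius_cong'[of "fps_nth (to_fps n ?c)" "\<lambda>_. 0"] by (simp add: fps_conv_radius_def)
  qed
  ultimately show ?thesis by (auto simp: puiseux_arc_def)
qed

text \<open>
  A coefficient \<open>z\<close> is generic as soon as it differs from the coefficients of all roots at
  height \<open>h(B)\<close>. At height \<open>0\<close> these coefficients are all \<open>0\<close>, and \<open>z\<close> must in addition be so small that
  \<open>(z, 0)\<close> lies in the domain of the factorisation.
\<close>
lemma nu_eq: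
  assumes F: "newton_puiseux F u E R" "holomorphic_germ F" and R: "R \<subseteq> \<Lambda>"
    and B: "proper_bar B" and \<xi>: "\<xi> \<in> members B"
  shows "nu F B = real E + (\<Sum>\<alpha>\<in>R. truncated_contact \<xi> (height B) \<alpha>)"
proof -
  obtain S m W where "newton_puiseux_chart F u E R S m W"
    using newton_puiseux_chart_exists[OF F] by blast
  then interpret newton_puiseux_chart F u E R S m W .
  define c where "c z = (\<lambda>e. stem B e + (if e = height B then z else 0))" for z
  let ?v = "real E + (\<Sum>\<alpha>\<in>R. truncated_contact \<xi> (height B) \<alpha>)"
  have c_at_h: "c z (height B) = z" for z by (simp add: c_def stem_def)
  have c_below: "\<forall>e<height B. c z e = \<xi> e" for z by (simp add: c_def stem_eq[OF B \<xi>])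
  have ord: "ord_y (along F (c z)) = ereal ?v"
    if z: "\<forall>\<alpha>\<in>R. z \<noteq> \<alpha> (height B)" and dom: "(c z 0, 0) \<in> S" "(c z 0, 0) \<in> W" for z
  proof -
    have "c z \<notin> R" using z c_at_h[of z] by auto
    then have "ord_y (along F (c z)) = ereal (real E + (\<Sum>\<alpha>\<in>R. real_of_ereal (contact (c z) \<alpha>)))"
      using generic_arc[OF B] dom by (intro ord_y_along) (auto simp: c_def)
    also have "(\<Sum>\<alpha>\<in>R. real_of_ereal (contact (c z) \<alpha>)) = (\<Sum>\<alpha>\<in>R. truncated_contact \<xi> (height B) \<alpha>)"
      unfolding truncated_contact_def using contact_branching[OF c_below[of z]] c_at_h[of z] z
      by (intro sum.cong) auto
    finally show ?thesis .
  qed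
  have generic: "\<forall>\<^sub>F z in generic B. ord_y (along F (c z)) = ereal ?v"
  proof (cases "height B = 0")
    case True
    have "open ((\<lambda>z. (z, 0)) -` (S \<inter> W))"
      using hol_F open_W by (intro open_vimage) (auto simp: holomorphic2_on_def intro!: continuous_intros)
    then have "\<forall>\<^sub>F z in nhds 0. z \<in> (\<lambda>z. (z, 0)) -` (S \<inter> W)"
      using origin by (intro eventually_nhds_in_open) auto
    then have "\<forall>\<^sub>F z in at 0. z \<in> (\<lambda>z. (z, 0)) -` (S \<inter> W) \<and> z \<noteq> 0"
      by (auto simp: eventually_at_filter elim: eventually_mono)
    then have "\<forall>\<^sub>F z in at 0. ord_y (along F (c z)) = ereal ?v"
    proof eventually_elim
      case (elim z)
      have "c z 0 = z" using c_at_h[of z] True by simp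
      moreover have "\<forall>\<alpha>\<in>R. z \<noteq> \<alpha> (height B)" using R root_0 elim True by auto
      ultimately show ?case using elim by (intro ord) auto
    qed
    then show ?thesis using True by (simp add: generic_def)
  next
    case False
    then have "height B > 0" using proper_barD(3)[OF B] by simp
    then have c0: "c z 0 = 0" for z
      using c_below[of z] root_0[of \<xi> 0] \<xi> proper_barD(1)[OF B] by auto
    have "finite ((\<lambda>\<alpha>. \<alpha> (height B)) ` R)" using finite_roots by simp
    then have "\<forall>\<^sub>F z in cofinite. z \<notin> (\<lambda>\<alpha>. \<alpha> (height B)) ` R"
      by (simp add: eventually_cofinite)
    then have "\<forall>\<^sub>F z in cofinite. ord_y (along F (c z)) = ereal ?v"
      by eventually_elim (intro ord, auto simp: c0 origin)
    then show ?thesis using False by (simp add: generic_def)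
  qed
  have "generic B \<noteq> bot"
    by (simp add: generic_def cofinite_bot infinite_UNIV_char_0)
  have "(THE v. \<forall>\<^sub>F z in generic B. ord_y (along F (c z)) = ereal v) = ?v"
  proof (rule the_equality)
    show "\<forall>\<^sub>F z in generic B. ord_y (along F (c z)) = ereal ?v" by (rule generic)
    fix v assume "\<forall>\<^sub>F z in generic B. ord_y (along F (c z)) = ereal v"
    with generic have "\<forall>\<^sub>F z in generic B. v = ?v" by eventually_elim simp
    then show "v = ?v" using \<open>generic B \<noteq> bot\<close> eventually_const by blast
  qed
  then show ?thesis by (simp add: nu_def c_def)
qed

end


section \<open>Zeros of a sum of simple fractions\<close>

text \<open>
  The numerator over the common denominator has degree exactly \<open>card S - 1\<close>, since its
  coefficient in this degree is the sum of the residues. It has no common zero with the denominator,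
  so its roots are the zeros of the sum, with the same multiplicities.
\<close>
lemma sum_zeros_partial_fractions:
  fixes d :: "complex \<Rightarrow> complex" and S :: "complex set"
  assumes fin: "finite S" and nz: "\<And>c. c \<in> S \<Longrightarrow> d c \<noteq> 0" and sum: "(\<Sum>c\<in>S. d c) \<noteq> 0"
  defines "r \<equiv> \<lambda>z. \<Sum>c\<in>S. d c / (z - c)"
  shows "(\<Sum>z | zorder r z > 0. nat (zorder r z)) + 1 = card S"
proof -
  define L where "L T = (\<Prod>b\<in>T. [:- b, 1:])" for T :: "complex set"
  define p where "p = (\<Sum>c\<in>S. smult (d c) (L (S - {c})))"
  have "S \<noteq> {}" using sum by auto
  then have card: "card S > 0" using fin by (simp add: card_gt_0_iff)
  have L: "degree (L T) = card T" "lead_coeff (L T) = 1" if "finite T" for T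
  proof -
    show "degree (L T) = card T" by (simp add: L_def degree_prod_eq_sum_degree)
    show "lead_coeff (L T) = 1" unfolding L_def by (subst lead_coeff_prod) simp
  qed
  have degL: "degree (L (S - {c})) = card S - 1" if "c \<in> S" for c
    using L(1)[of "S - {c}"] fin that by simp
  have "coeff p (card S - 1) = (\<Sum>c\<in>S. d c)"
    unfolding p_def coeff_sum
    using degL L(2)[of "S - {c}" for c] fin by (intro sum.cong) (auto, metis finite_Diff mult.right_neutral)
  moreover have "degree p \<le> card S - 1"
    unfolding p_def by (rule degree_sum_le[OF fin]) (metis degL degree_smult_le)
  ultimately have deg: "degree p = card S - 1"
    using sum le_degree[of p "card S - 1"] by simp
  have p0: "p \<noteq> 0" using sum \<open>coeff p (card S - 1) = _\<close> by auto
  have poly_L: "poly (L T) w = (\<Prod>b\<in>T. w - b)" for T w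
    by (simp add: L_def poly_prod)
  \<comment> \<open>At its poles, \<open>r\<close> takes values that division by zero makes meaningless.\<close>
  have poly_p: "poly p w = r w * poly (L S) w" if "w \<notin> S" for w
  proof -
    have "poly p w = (\<Sum>c\<in>S. d c * poly (L (S - {c})) w)" by (simp add: p_def poly_sum)
    also have "\<dots> = (\<Sum>c\<in>S. d c / (w - c) * poly (L S) w)"
    proof (rule sum.cong[OF refl])
      fix c assume "c \<in> S"
      then have "poly (L S) w = (w - c) * poly (L (S - {c})) w"
        using fin by (simp add: poly_L prod.remove)
      then show "d c * poly (L (S - {c})) w = d c / (w - c) * poly (L S) w"
        using that \<open>c \<in> S\<close> by auto
    qed
    finally show ?thesis by (simp add: r_def sum_distrib_right)
  qed
  have LS0: "poly (L S) w \<noteq> 0" if "w \<notin> S" for w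
    using that fin by (auto simp: poly_L)
  have poly_p_pole: "poly p c \<noteq> 0" if c: "c \<in> S" for c
  proof -
    have "poly p c = (\<Sum>b\<in>S. d b * poly (L (S - {b})) c)" by (simp add: p_def poly_sum)
    also have "\<dots> = (\<Sum>b\<in>{c}. d b * poly (L (S - {b})) c)"
      by (rule sum.mono_neutral_right) (use fin c in \<open>auto simp: poly_L\<close>)
    also have "\<dots> \<noteq> 0" using nz[OF c] fin by (auto simp: poly_L)
    finally show ?thesis .
  qed
  have zorder_pole: "zorder r c = -1" if c: "c \<in> S" for c
  proof (rule zorder_eqI[where S = "- (S - {c})"
        and g = "\<lambda>w. d c + (w - c) * (\<Sum>b\<in>S - {c}. d b / (w - b))"])
    show "open (- (S - {c}))" using fin by (intro open_Compl finite_imp_closed) auto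
    show "(\<lambda>w. d c + (w - c) * (\<Sum>b\<in>S - {c}. d b / (w - b))) holomorphic_on - (S - {c})"
      by (intro holomorphic_intros) auto
    show "d c + (c - c) * (\<Sum>b\<in>S - {c}. d b / (c - b)) \<noteq> 0" using nz[OF c] by simp
    fix w assume "w \<in> - (S - {c})" "w \<noteq> c"
    then show "r w = (d c + (w - c) * (\<Sum>b\<in>S - {c}. d b / (w - b))) * (w - c) powi - 1"
      using fin c by (simp add: r_def sum.remove power_int_minus field_simps)
  qed auto
  have zorder_other: "zorder r z = int (order z p)" if z: "z \<notin> S" for z
  proof -
    obtain q where q: "p = [:- z, 1:] ^ order z p * q" "\<not> [:- z, 1:] dvd q"
      using order_decomp[OF p0] by blast
    show ?thesis
    proof (rule zorder_eqI[where S = "- S" and g = "\<lambda>w. poly q w / poly (L S) w"])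
      show "open (- S)" using fin by (intro open_Compl finite_imp_closed) auto
      show "(\<lambda>w. poly q w / poly (L S) w) holomorphic_on - S"
        using LS0 by (intro holomorphic_intros) auto
      show "poly q z / poly (L S) z \<noteq> 0" using LS0[OF z] q(2) by (simp add: poly_eq_0_iff_dvd)
      fix w assume w: "w \<in> - S"
      have "poly p w = (w - z) ^ order z p * poly q w"
        by (subst q(1)) (simp add: poly_power)
      then show "r w = poly q w / poly (L S) w * (w - z) powi int (order z p)"
        using poly_p[of w] LS0[of w] w by (simp add: field_simps)
    qed (use z in auto)
  qed
  have "{z. zorder r z > 0} = {z. poly p z = 0}"
  proof (intro set_eqI)
    fix z show "z \<in> {z. zorder r z > 0} \<longleftrightarrow> z \<in> {z. poly p z = 0}"
      using zorder_pole[of z] zorder_other[of z] poly_p_pole[of z] order_root[of p z] p0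
      by (cases "z \<in> S") auto
  qed
  moreover have "nat (zorder r z) = count (proots p) z" if "poly p z = 0" for z
    using zorder_other[of z] poly_p_pole[of z] that p0 by (cases "z \<in> S") auto
  ultimately have "(\<Sum>z | zorder r z > 0. nat (zorder r z)) = (\<Sum>z\<in>set_mset (proots p). count (proots p) z)"
    using p0 by (intro sum.cong) auto
  also have "\<dots> = degree p" by (simp flip: size_multiset_overloaded_eq add: size_proots_complex)
  finally show ?thesis using deg card by simp
qed


section \<open>Postbars at non-collinear points\<close>

theorem theoremN:
  fixes f g u u' :: "complex \<times> complex \<Rightarrow> complex"
    and E\<^sub>1 E\<^sub>2 :: nat
    and P Q :: "frac_series set"
    and B B' :: bar
    and z :: complex
  assumes "holomorphic_germ f" and "f (0, 0) = 0"
    and "holomorphic_germ g" and "g (0, 0) = 0"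
    and "newton_puiseux f u E\<^sub>1 P"
    and "newton_puiseux g u' E\<^sub>2 Q"
    and "P \<inter> Q = {}" and "P \<union> Q \<noteq> {}"
    and "is_bar (P \<union> Q) B"
    and "z \<in> noncollinear_points f g P Q B"
    and "is_postbar B z B'"
  shows "num_zeros f g P Q B' + 1 = num_noncollinear f g P Q B' \<and>
         noncollinear f g P Q B' \<and>
         (\<forall>\<gamma>. polar_root f g \<gamma> \<and> climbs_over_at \<gamma> B z \<longrightarrow> climbs_over \<gamma> B') \<and>
         \<not> (\<exists>\<gamma>. polar_root f g \<gamma> \<and>
              ereal (height B) < contact \<gamma> (stem B') \<and> contact \<gamma> (stem B') < ereal (height B'))"
proof -
  note f = assms(5,1) and g = assms(6,3)
  obtain n where n: "\<forall>\<alpha>\<in>P \<union> Q. ramified n \<alpha>"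
    using newton_puiseux_common_ramification[OF assms(5,6)] by blast
  interpret root_tree "P \<union> Q" n
    using assms(5,6,8) n by unfold_locales (auto simp: newton_puiseux_def)
  define T where "T = members B'"
  define h where "h = height B"
  define h' where "h' = height B'"
  have B: "proper_bar B" by (rule is_bar_proper[OF assms(9)])
  have grows: "grows_at T B z" and height_T: "trunk_height T = ereal h'"
    using assms(11) by (auto simp: is_postbar_def T_def h'_def)
  have T: "T \<in> trunks B" using grows by (simp add: grows_at_def)
  have "B' = Bar T h'" by (simp add: T_def h'_def)
  then have B': "proper_bar B'" and hh': "h < h'"
    using bar_on_trunk[OF B T height_T] by (simp_all add: h_def)
  have h0: "h \<ge> 0" using proper_barD(3)[OF B] by (simp add: h_def)
  obtain \<xi> where \<xi>: "\<xi> \<in> T" using trunk_nonempty[OF T] by blast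
  have \<xi>B: "\<xi> \<in> members B" using \<xi> trunk_subset[OF T] by blast
  have \<xi>B': "\<xi> \<in> members B'" using \<xi> by (simp add: T_def)
  have \<xi>\<Lambda>: "\<xi> \<in> P \<union> Q" using \<xi>B proper_barD(1)[OF B] by blast
  have stem_\<xi>: "stem B' e = \<xi> e" if "e < h'" for e
    using stem_eq[OF B' \<xi>B'] that by (simp add: h'_def)
  define s where "s = real (card (T \<inter> P))"
  define t where "t = real (card (T \<inter> Q))"
  define \<nu>f where "\<nu>f = nu f B"
  define \<nu>g where "\<nu>g = nu g B"
  define \<Delta> where "\<Delta> = \<nu>f * t - \<nu>g * s"
  have cut_f: "real E\<^sub>1 + (\<Sum>\<alpha>\<in>P. truncated_contact \<xi> x \<alpha>) = \<nu>f + s * (x - h)" if "h \<le> x" "x \<le> h'" for x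
    using sum_truncated_contact_above_trunk[OF B T height_T \<xi>, of x P] nu_eq[OF f _ B \<xi>B] that
    by (simp add: \<nu>f_def s_def h_def)
  have cut_g: "real E\<^sub>2 + (\<Sum>\<alpha>\<in>Q. truncated_contact \<xi> x \<alpha>) = \<nu>g + t * (x - h)" if "h \<le> x" "x \<le> h'" for x
    using sum_truncated_contact_above_trunk[OF B T height_T \<xi>, of x Q] nu_eq[OF g _ B \<xi>B] that
    by (simp add: \<nu>g_def t_def h_def)
  have "Delta f g P Q B z = \<Delta>"
    using trunk_at_eq[OF B grows] by (simp add: Delta_def \<Delta>_def \<nu>f_def \<nu>g_def s_def t_def)
  then have \<Delta>: "\<Delta> \<noteq> 0" using assms(10) by (auto simp: noncollinear_points_def)
  \<comment> \<open>The key invariance: the expression does not depend on the height \<open>x\<close>.\<close>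
  have invariant: "(\<nu>f + s * (x - h)) * t - (\<nu>g + t * (x - h)) * s = \<Delta>" for x
    by (simp add: \<Delta>_def algebra_simps)

  have sum_Delta: "(\<Sum>c\<in>growth_points B'. Delta f g P Q B' c) = \<Delta>"
  proof -
    have card_sum: "(\<Sum>c\<in>growth_points B'. real (card (trunk_at B' c \<inter> R))) = real (card (T \<inter> R))" for R
      using sum_card_trunks[OF B', of R] by (simp add: T_def flip: of_nat_sum)
    have "(\<Sum>c\<in>growth_points B'. Delta f g P Q B' c) = nu f B' * t - nu g B' * s"
      by (simp add: Delta_def sum_subtractf card_sum s_def t_def flip: sum_distrib_left)
    moreover have "nu f B' = \<nu>f + s * (h' - h)" "nu g B' = \<nu>g + t * (h' - h)"
      using nu_eq[OF f _ B' \<xi>B'] nu_eq[OF g _ B' \<xi>B'] cut_f[of h'] cut_g[of h'] hh'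
      by (simp_all add: h'_def)
    ultimately show ?thesis using invariant[of h'] by simp
  qed
  define N where "N = noncollinear_points f g P Q B'"
  have fin: "finite (growth_points B')" using growth_points_eq[OF B'] proper_barD(4)[OF B'] by simp
  have N_sub: "N \<subseteq> growth_points B'" by (auto simp: N_def noncollinear_points_def)
  then have fin_N: "finite N" using fin finite_subset by blast
  have outside: "Delta f g P Q B' c = 0" if "c \<in> growth_points B' - N" for c
    using that by (simp add: N_def noncollinear_points_def)
  have ratfun: "ratfun f g P Q B' = (\<lambda>w. \<Sum>c\<in>N. of_real (Delta f g P Q B' c) / (w - c))"
    unfolding ratfun_def using fin N_sub outside
    by (intro ext sum.mono_neutral_right) auto
  have "(\<Sum>c\<in>N. complex_of_real (Delta f g P Q B' c)) = of_real (\<Sum>c\<in>growth_points B'. Delta f g P Q B' c)"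
    unfolding of_real_sum using fin N_sub outside by (intro sum.mono_neutral_left) auto
  then have sum_N: "(\<Sum>c\<in>N. complex_of_real (Delta f g P Q B' c)) \<noteq> 0"
    using sum_Delta \<Delta> by simp
  have zeros: "num_zeros f g P Q B' + 1 = num_noncollinear f g P Q B'"
    unfolding num_zeros_def num_noncollinear_def N_def[symmetric] ratfun
    by (rule sum_zeros_partial_fractions[OF fin_N _ sum_N])
      (simp add: N_def noncollinear_points_def)
  have noncoll: "noncollinear f g P Q B'"
    using sum_N by (auto simp: noncollinear_def N_def)

  \<comment> \<open>A polar root in the gap would separate from all of \<open>T\<close> at one height \<open>k\<close> and with one
    leading coefficient \<open>\<gamma> k - \<xi> k\<close>.\<close>
  have gap: "\<not> (ereal h < contact \<gamma> \<xi> \<and> contact \<gamma> \<xi> < ereal h')" if polar: "polar_root f g \<gamma>" for \<gamma>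
  proof
    assume *: "ereal h < contact \<gamma> \<xi> \<and> contact \<gamma> \<xi> < ereal h'"
    then obtain k where k: "contact \<gamma> \<xi> = ereal k" "h < k" "k < h'"
      by (cases "contact \<gamma> \<xi>") auto
    obtain m where m: "ramified m \<gamma>" using polar by (auto simp: polar_root_def puiseux_arc_def)
    have "ramified (n * m) \<xi>" "ramified (m * n) \<gamma>"
      using ramified_mult ram[OF \<xi>\<Lambda>] m n_pos by (auto simp: ramified_def)
    then have diff: "\<gamma> k \<noteq> \<xi> k"
      using contact_attained[OF _ _ k(1), of "m * n"] by (simp add: mult.commute)
    have below: "\<forall>e<k. \<gamma> e = \<xi> e" using contact_ge_iff[of k \<gamma> \<xi>] k(1) by simp
    have in_T: "\<alpha> k = \<xi> k" if "\<alpha> \<in> T" for \<alpha>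
      using stem_\<xi>[OF k(3)] stem_eq[OF B', of \<alpha> k] that k(3) by (simp add: T_def h'_def)
    have off_T: "contact \<xi> \<alpha> < ereal k" if "\<alpha> \<in> P \<union> Q" "\<alpha> \<notin> T" for \<alpha>
      using trunk_separation[OF B T \<xi> that(1)] that(2) k(2)
      by (simp add: h_def not_less) (meson ereal_less(1) le_less_trans less_ereal.simps(1))
    have contact_\<gamma>: "contact \<gamma> \<alpha> = min (ereal k) (contact \<xi> \<alpha>)" if "\<alpha> \<in> P \<union> Q" for \<alpha>
    proof (cases "\<alpha> \<in> T")
      case True
      then show ?thesis using contact_branching[OF below, of \<alpha>] diff in_T by simp
    next
      case False
      then show ?thesis
        using contact_agree_upto[OF below] off_T[OF that] by (simp add: min_absorb2 less_imp_le)
    qed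
    have eq_k: "contact \<gamma> \<alpha> = ereal k \<longleftrightarrow> \<alpha> \<in> T" if "\<alpha> \<in> P \<union> Q" for \<alpha>
    proof
      assume "contact \<gamma> \<alpha> = ereal k"
      then show "\<alpha> \<in> T" using contact_\<gamma>[OF that] off_T[OF that]
        by (cases "\<alpha> \<in> T") (auto simp: min_def split: if_splits)
    next
      assume "\<alpha> \<in> T"
      then have "ereal h' \<le> contact \<xi> \<alpha>"
        using proper_barD(5)[OF B' \<xi>B', of \<alpha>] by (simp add: T_def h'_def)
      then have "ereal k \<le> contact \<xi> \<alpha>" using k(3) by (meson ereal_less_eq(3) less_imp_le order_trans)
      then show "contact \<gamma> \<alpha> = ereal k" using contact_\<gamma>[OF that] by (simp add: min_absorb1)
    qed
    have sets: "{\<alpha>\<in>P. contact \<gamma> \<alpha> = ereal k} = T \<inter> P" "{\<beta>\<in>Q. contact \<gamma> \<beta> = ereal k} = T \<inter> Q"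
      using eq_k by auto
    have cuts: "(\<Sum>\<alpha>\<in>P. real_of_ereal (contact \<gamma> \<alpha>)) = (\<Sum>\<alpha>\<in>P. truncated_contact \<xi> k \<alpha>)"
      "(\<Sum>\<alpha>\<in>Q. real_of_ereal (contact \<gamma> \<alpha>)) = (\<Sum>\<alpha>\<in>Q. truncated_contact \<xi> k \<alpha>)"
      using contact_\<gamma> by (auto simp: truncated_contact_def intro!: sum.cong)
    have "(real E\<^sub>1 + (\<Sum>\<alpha>\<in>P. truncated_contact \<xi> k \<alpha>)) * t = (real E\<^sub>2 + (\<Sum>\<beta>\<in>Q. truncated_contact \<xi> k \<beta>)) * s"
      unfolding s_def t_def cuts[symmetric] sets[symmetric]
    proof (rule polar_root_balance[OF f g polar])
      show "k > 0" using h0 k by simp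
      show "\<gamma> k - \<xi> k \<noteq> 0" using diff by simp
      show "contact \<gamma> \<alpha> \<le> ereal k" if "\<alpha> \<in> P \<union> Q" for \<alpha> using contact_\<gamma>[OF that] by simp
      show "\<gamma> k - \<alpha> k = \<gamma> k - \<xi> k" if "\<alpha> \<in> P \<union> Q" "contact \<gamma> \<alpha> = ereal k" for \<alpha>
        using eq_k[OF that(1)] that(2) in_T by simp
    qed
    then show False using cut_f[of k] cut_g[of k] invariant[of k] k \<Delta> by simp
  qed

  have "climbs_over \<gamma> B'" if polar: "polar_root f g \<gamma>" and climb: "climbs_over_at \<gamma> B z" for \<gamma>
  proof -
    obtain m where m: "ramified m \<gamma>" using polar by (auto simp: polar_root_def puiseux_arc_def)
    \<comment> \<open>By discreteness, agreement up to and including \<open>h\<close> lifts the contact above \<open>h\<close>.\<close>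
    have ram': "ramified (m * n) \<gamma>" "ramified (m * n) \<xi>"
      using ramified_mult[OF m n_pos] ramified_mult[OF ram[OF \<xi>\<Lambda>], of m] m
      by (auto simp: ramified_def mult.commute)
    have "climbs_over_at \<xi> B z" using grows \<xi> by (simp add: grows_at_def)
    then have "\<forall>e<h. \<gamma> e = \<xi> e" "\<gamma> h = \<xi> h" using climb by (auto simp: climbs_over_at_def h_def)
    then have "ereal h < contact \<gamma> \<xi>" using contact_gt_iff[OF ram'] by simp
    then have "ereal h' \<le> contact \<gamma> \<xi>" using gap[OF polar] by (simp add: not_less)
    then have "\<forall>e<h'. \<gamma> e = stem B' e" using stem_\<xi> by (simp add: contact_ge_iff)
    then show ?thesis by (simp add: climbs_over_def climbs_over_at_def h'_def)
  qed
  moreover have "\<not> (ereal h < contact \<gamma> (stem B') \<and> contact \<gamma> (stem B') < ereal h')"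
    if polar: "polar_root f g \<gamma>" for \<gamma>
  proof
    assume *: "ereal h < contact \<gamma> (stem B') \<and> contact \<gamma> (stem B') < ereal h'"
    have "contact \<xi> \<gamma> = contact (stem B') \<gamma>"
      by (rule contact_agree_upto[of h']) (use stem_\<xi> * in \<open>auto simp: contact_commute\<close>)
    then have "contact \<gamma> \<xi> = contact \<gamma> (stem B')" by (simp add: contact_commute)
    then show False using gap[OF polar] * by simp
  qed
  ultimately show ?thesis using zeros noncoll unfolding h_def h'_def by blast
qed

end
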